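(* Let $\ell,\ell'$ be geodesic lines of $\mathbb{H}^2$ and $g,g'\in G_0$. Consider: (C) the right $\mathrm{AdS}$ crooked planes $g\mathsf{C}^*(\ell)$ and $g'\mathsf{C}^*(\ell')$ are disjoint; (D) the geodesic lines $\ell$ and $\ell'$ are disjoint, and $g^{-1}g'\in\mathsf{SQ}(\ell)\,\mathsf{SQ}(\ell')^{-1}$ for the transverse orientations of $\ell,\ell'$ pointing away from each other. Then (C) implies (D). Moreover, if $g$ and $g'$ take $\ell$ and $\ell'$ to disjoint geodesics $g\cdot\ell$, $g'\cdot\ell'$ whose transverse orientations (induced by $g,g'$ from those of $\ell,\ell'$ pointing away from each other) point away from each other, then (D) implies (C).
   Context: $G_0=\mathrm{PSL}_2(\mathbb{R})$ acts on the hyperbolic plane $\mathbb{H}^2$; $\mathrm{AdS}^3$ is identified with $G_0$. For a geodesic line $\ell$ with closure $\overline\ell$ in $\mathbb{H}^2\cup\partial_\infty\mathbb{H}^2$, $\mathsf{C}^*(\ell)$ is the set of $h\in G_0$ having a nonattracting fixed point in $\overline\ell$ (identity: every point; elliptic: its fixed point; parabolic: its fixed point at infinity; hyperbolic: its repelling fixed point). For a transversely oriented geodesic line $\ell$, the stem quadrant $\mathsf{SQ}(\ell)\subset G_0$ is the set of hyperbolic elements whose translation axis is orthogonal to $\ell$ and which translate towards the positive side of $\ell$. For subsets $A,B\subset G_0$, $AB=\{ab\}$ and $A^{-1}=\{a^{-1}\}$. *)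

theory Defs
  imports "HOL-Analysis.Analysis"
begin

text \<open>Elements of G0 = PSL2(R) are represented by their lifts in SL2(R), i.e. real 2x2
matrices of determinant 1. Every set of group elements used below is invariant under
A to -A, so membership/disjointness statements are the same as in PSL2(R).\<close>

definition SL2 :: "(real^2^2) set" where
  "SL2 = {A. det A = 1}"

definition H2 :: "complex set" where
  "H2 = {z. Im z > 0}"

text \<open>Ideal boundary: real line plus infinity (None).\<close>
type_synonym bdpt = "real option"

definition mob :: "real^2^2 \<Rightarrow> complex \<Rightarrow> complex" where
  "mob A z = (of_real (A$1$1) * z + of_real (A$1$2)) / (of_real (A$2$1) * z + of_real (A$2$2))"

fun bd_act :: "real^2^2 \<Rightarrow> bdpt \<Rightarrow> bdpt" where
  "bd_act A (Some x) = (if A$2$1 * x + A$2$2 = 0 then None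
                        else Some ((A$1$1 * x + A$1$2) / (A$2$1 * x + A$2$2)))"
| "bd_act A None = (if A$2$1 = 0 then None else Some (A$1$1 / A$2$1))"

fun bd_vec :: "bdpt \<Rightarrow> real^2" where
  "bd_vec (Some x) = (\<chi> i. if i = 1 then x else 1)"
| "bd_vec None = (\<chi> i. if i = 1 then 1 else 0)"

definition is_id :: "real^2^2 \<Rightarrow> bool" where
  "is_id A \<longleftrightarrow> A = mat 1 \<or> A = - mat 1"

definition elliptic :: "real^2^2 \<Rightarrow> bool" where
  "elliptic A \<longleftrightarrow> \<not> is_id A \<and> (\<exists>z\<in>H2. mob A z = z)"

definition parabolic :: "real^2^2 \<Rightarrow> bool" where
  "parabolic A \<longleftrightarrow> \<not> is_id A \<and> \<not> (\<exists>z\<in>H2. mob A z = z) \<and> (\<exists>!\<xi>. bd_act A \<xi> = \<xi>)"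

definition hyperbolic :: "real^2^2 \<Rightarrow> bool" where
  "hyperbolic A \<longleftrightarrow> \<not> is_id A \<and> (\<exists>\<xi> \<eta>. \<xi> \<noteq> \<eta> \<and> bd_act A \<xi> = \<xi> \<and> bd_act A \<eta> = \<eta>)"

text \<open>Repelling fixed point of a hyperbolic element: a boundary fixed point whose
eigenvalue has absolute value < 1 (equivalently the derivative of the boundary action
there has absolute value > 1).\<close>
definition repelling_fp :: "real^2^2 \<Rightarrow> bdpt \<Rightarrow> bool" where
  "repelling_fp A \<xi> \<longleftrightarrow> hyperbolic A \<and> bd_act A \<xi> = \<xi> \<and>
     (\<exists>k. \<bar>k\<bar> < 1 \<and> A *v bd_vec \<xi> = k *\<^sub>R bd_vec \<xi>)"

fun geod :: "bdpt \<Rightarrow> bdpt \<Rightarrow> complex set" where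
  "geod (Some p) (Some q) = {z \<in> H2. cmod (z - of_real ((p + q) / 2)) = \<bar>p - q\<bar> / 2}"
| "geod (Some p) None = {z \<in> H2. Re z = p}"
| "geod None (Some q) = {z \<in> H2. Re z = q}"
| "geod None None = {}"

definition is_geod :: "complex set \<Rightarrow> bool" where
  "is_geod L \<longleftrightarrow> (\<exists>p q. p \<noteq> q \<and> L = geod p q)"

text \<open>Endpoints at infinity; the closure of L in H2 \<union> boundary is L together with these.\<close>
definition ends :: "complex set \<Rightarrow> bdpt set" where
  "ends L = {p. \<exists>q. p \<noteq> q \<and> L = geod p q}"

text \<open>Euclidean tangent direction of the geodesic with endpoints p, q at a point z
(the model is conformal, so Euclidean angles are hyperbolic angles).\<close>
fun gtan :: "bdpt \<Rightarrow> bdpt \<Rightarrow> complex \<Rightarrow> complex" where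
  "gtan (Some p) (Some q) z = \<i> * (z - of_real ((p + q) / 2))"
| "gtan _ _ z = \<i>"

definition orthogonal_geods :: "complex set \<Rightarrow> complex set \<Rightarrow> bool" where
  "orthogonal_geods L1 L2 \<longleftrightarrow> (\<exists>p q p' q' z. p \<noteq> q \<and> p' \<noteq> q' \<and>
      L1 = geod p q \<and> L2 = geod p' q' \<and> z \<in> L1 \<and> z \<in> L2 \<and>
      Re (gtan p q z * cnj (gtan p' q' z)) = 0)"

definition trans_axis :: "real^2^2 \<Rightarrow> complex set \<Rightarrow> bool" where
  "trans_axis A L \<longleftrightarrow> hyperbolic A \<and>
     (\<exists>\<xi> \<eta>. \<xi> \<noteq> \<eta> \<and> bd_act A \<xi> = \<xi> \<and> bd_act A \<eta> = \<eta> \<and> L = geod \<xi> \<eta>)"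

text \<open>A transverse orientation of L is given by its positive side, a component of H2 - L.
For disjoint L, L', the orientation of L pointing away from L' has as positive side
the component of H2 - L not meeting L'.\<close>
definition away :: "complex set \<Rightarrow> complex set \<Rightarrow> complex set" where
  "away L L' = \<Union> {C \<in> components (H2 - L). C \<inter> L' = {}}"

definition Cstar :: "complex set \<Rightarrow> (real^2^2) set" where
  "Cstar L = {h \<in> SL2.
      is_id h
    \<or> (elliptic h \<and> (\<exists>z\<in>L. mob h z = z))
    \<or> (parabolic h \<and> (\<exists>\<xi>\<in>ends L. bd_act h \<xi> = \<xi>))
    \<or> (hyperbolic h \<and> (\<exists>\<xi>\<in>ends L. repelling_fp h \<xi>))}"

definition SQ :: "complex set \<Rightarrow> complex set \<Rightarrow> (real^2^2) set" where
  "SQ L P = {h \<in> SL2. hyperbolic h \<and>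
      (\<exists>Ax. trans_axis h Ax \<and> orthogonal_geods Ax L \<and> (\<forall>z \<in> Ax \<inter> L. mob h z \<in> P))}"

definition setmul :: "(real^2^2) set \<Rightarrow> (real^2^2) set \<Rightarrow> (real^2^2) set" where
  "setmul A B = {a ** b | a b. a \<in> A \<and> b \<in> B}"

definition setinv :: "(real^2^2) set \<Rightarrow> (real^2^2) set" where
  "setinv A = matrix_inv ` A"

definition translate :: "real^2^2 \<Rightarrow> (real^2^2) set \<Rightarrow> (real^2^2) set" where
  "translate g A = (\<lambda>h. g ** h) ` A"

end

theory Submission
  imports Defs
begin

text \<open>Represent the endpoints of \<open>L\<close> and \<open>L'\<close> by vectors \<open>u, v\<close> and \<open>x, y\<close> of the plane, write \<open>wd\<close> for
the area form and put \<open>h = g\<^sup>-\<^sup>1 g'\<close>, so that (C) says that no \<open>A \<in> Cstar L\<close> and \<open>B \<in> Cstar L'\<close>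
satisfy \<open>A = h B\<close>. A point of the closure of \<open>L\<close> is a form \<open>s u\<^sup>2 + t v\<^sup>2\<close> with \<open>s, t \<ge> 0\<close>, and having
it as a nonattracting fixed point means multiplying the form by a factor in \<open>(0, 1]\<close>. As the
pairing of forms is bilinear, (C) reduces to its instances at the endpoints, namely
\<open>(wd a (h b))\<^sup>2 < (wd a b)\<^sup>2\<close> for \<open>a \<in> {u, v}\<close> and \<open>b \<in> {x, y}\<close>. Let \<open>M\<close> and \<open>N\<close> be the 2 by 2 matrices of
the numbers \<open>wd a b\<close> and \<open>wd a (h b)\<close>. If \<open>L\<close> and \<open>L'\<close> are disjoint, the vectors can be chosen so that
\<open>M \<ge> 0\<close>, and \<open>h \<in> SQ(L) SQ(L')\<^sup>-\<^sup>1\<close> then means \<open>M = S N T\<close>, up to sign, where \<open>S\<close> and \<open>T\<close> are positive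
matrices of determinant 1 with equal diagonal entries. If the translated geodesics point away from
each other, the entries of \<open>N\<close> have the same sign, and \<open>M = S N T\<close> gives \<open>|N| < M\<close>. Conversely, \<open>S\<close>
and \<open>T\<close> are found from \<open>|N| < M\<close> and \<open>det N = det M\<close> by solving a linear system.\<close>

subsection \<open>Lifts of boundary points and the action on \<open>H2\<close>\<close>

definition wd :: "real^2 \<Rightarrow> real^2 \<Rightarrow> real" where
  "wd u v = u$1 * v$2 - u$2 * v$1"

text \<open>A boundary point is a line in the plane. Every nonzero vector of the line counts as a
  lift, which leaves signs free to be chosen later.\<close>

definition lift :: "bdpt \<Rightarrow> real^2 \<Rightarrow> bool" where
  "lift \<xi> v \<longleftrightarrow> (\<exists>c. c \<noteq> 0 \<and> v = c *\<^sub>R bd_vec \<xi>)"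

text \<open>\<open>Qf u v z\<close> is the real part of \<open>(u$1 - u$2 * z) * cnj (v$1 - v$2 * z)\<close>: it vanishes on the geodesic
whose endpoints are represented by \<open>u\<close> and \<open>v\<close>, and its sign tells the two sides apart.\<close>
definition Qf :: "real^2 \<Rightarrow> real^2 \<Rightarrow> complex \<Rightarrow> real" where
  "Qf u v z = u$1 * v$1 - (u$1 * v$2 + u$2 * v$1) * Re z + u$2 * v$2 * ((Re z)\<^sup>2 + (Im z)\<^sup>2)"

text \<open>The squared modulus of the denominator of \<open>mob A z\<close>: the factor relating
  heights and forms at \<open>z\<close> to those at \<open>mob A z\<close>.\<close>

definition jac :: "real^2^2 \<Rightarrow> complex \<Rightarrow> real" where
  "jac A z = (A$2$1 * Re z + A$2$2)\<^sup>2 + (A$2$1 * Im z)\<^sup>2"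

section \<open>Linear algebra of the area form\<close>

lemma mult_vec_2:
  fixes A :: "real^2^2"
  shows "(A *v u) $ 1 = A$1$1 * u$1 + A$1$2 * u$2" "(A *v u) $ 2 = A$2$1 * u$1 + A$2$2 * u$2"
  by (simp_all add: matrix_vector_mult_def sum_2)

lemma bd_vec_nth [simp]:
  "bd_vec (Some x) $ 1 = x" "bd_vec (Some x) $ 2 = 1" "bd_vec None $ 1 = 1" "bd_vec None $ 2 = 0"
  by simp_all

declare bd_vec.simps [simp del]

lemma SL2_det: "A \<in> SL2 \<longleftrightarrow> A$1$1 * A$2$2 - A$1$2 * A$2$1 = 1"
  by (simp add: SL2_def det_2)

lemma wd_self [simp]: "wd u u = 0"
  by (simp add: wd_def)

lemma wd_swap: "wd v u = - wd u v"
  by (simp add: wd_def)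

lemma wd_add [simp]: "wd (u + v) w = wd u w + wd v w" "wd u (v + w) = wd u v + wd u w"
  by (simp_all add: wd_def algebra_simps)

lemma wd_minus [simp]: "wd (- u) w = - wd u w" "wd u (- w) = - wd u w"
  by (simp_all add: wd_def algebra_simps)

lemma wd_diff [simp]: "wd (u - v) w = wd u w - wd v w" "wd u (v - w) = wd u v - wd u w"
  by (simp_all add: wd_def algebra_simps)

lemma wd_scaleR [simp]: "wd (c *\<^sub>R u) w = c * wd u w" "wd u (c *\<^sub>R w) = c * wd u w"
  by (simp_all add: wd_def algebra_simps)

lemma wd_zero [simp]: "wd 0 u = 0" "wd u 0 = 0"
  by (simp_all add: wd_def)

lemma wd_mult: "wd (A *v u) (A *v v) = det A * wd u v"
  by (simp add: wd_def mult_vec_2 det_2 algebra_simps)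

lemma wd_SL2: "A \<in> SL2 \<Longrightarrow> wd (A *v u) (A *v v) = wd u v"
  by (simp add: wd_mult SL2_def)

text \<open>Cramer's rule in the plane, with denominators cleared.\<close>

lemma wd_expand: "wd u v *\<^sub>R x = wd x v *\<^sub>R u + wd u x *\<^sub>R v"
  by (simp add: vec_eq_iff forall_2 wd_def algebra_simps)

lemma wd_basis:
  assumes "wd u v \<noteq> 0"
  obtains a b where "x = a *\<^sub>R u + b *\<^sub>R v"
proof
  have "x = (1 / wd u v) *\<^sub>R (wd u v *\<^sub>R x)"
    using assms by simp
  also have "\<dots> = (wd x v / wd u v) *\<^sub>R u + (wd u x / wd u v) *\<^sub>R v"
    unfolding wd_expand[of u v x] by (simp add: scaleR_add_right)
  finally show "x = (wd x v / wd u v) *\<^sub>R u + (wd u x / wd u v) *\<^sub>R v" .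
qed

lemma wd_zero_imp_parallel:
  assumes "wd u v = 0" "u \<noteq> 0"
  obtains k where "v = k *\<^sub>R u"
proof (cases "u$1 = 0")
  case True
  then have "u$2 \<noteq> 0" using assms(2) by (auto simp: vec_eq_iff forall_2)
  with True assms(1) have "v = (v$2 / u$2) *\<^sub>R u"
    by (simp add: vec_eq_iff forall_2 wd_def)
  then show ?thesis by (rule that)
next
  case False
  then have "v = (v$1 / u$1) *\<^sub>R u"
    using assms(1) by (simp add: vec_eq_iff forall_2 wd_def field_simps)
  then show ?thesis by (rule that)
qed

lemma vec_eq_by_wd:
  assumes "wd u v \<noteq> 0" "wd u x = wd u y" "wd v x = wd v y"
  shows "x = y"
proof -
  have "wd u v *\<^sub>R x = wd u v *\<^sub>R y"
    unfolding wd_expand[of u v x] wd_expand[of u v y]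
    using assms wd_swap[of x v] wd_swap[of y v] by simp
  then show ?thesis using assms by simp
qed

lemma mat_eq_on_basis:
  fixes A B :: "real^2^2"
  assumes "wd u v \<noteq> 0" "A *v u = B *v u" "A *v v = B *v v"
  shows "A = B"
proof -
  have "A *v x = B *v x" for x
  proof -
    obtain a b where "x = a *\<^sub>R u + b *\<^sub>R v" using wd_basis[OF assms(1)] .
    then show ?thesis using assms by (simp add: matrix_vector_right_distrib matrix_vector_mult_scaleR)
  qed
  then show ?thesis by (simp add: matrix_eq)
qed

lemma mat_on_basis_exists:
  assumes "wd u v \<noteq> 0"
  obtains A :: "real^2^2" where "A *v u = x" "A *v v = y"
proof -
  \<comment> \<open>The matrix with columns \<open>x\<close>, \<open>y\<close> times the inverse of
    the matrix with columns \<open>u\<close>, \<open>v\<close>.\<close>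
  define A :: "real^2^2" where "A = (\<chi> i j. if j = 1 then (x$i * v$2 - y$i * u$2) / wd u v
     else (y$i * u$1 - x$i * v$1) / wd u v)"
  have "A *v u = x"
  proof -
    have "((x$i * v$2 - y$i * u$2) / wd u v) * u$1 + ((y$i * u$1 - x$i * v$1) / wd u v) * u$2 = x$i" for i
      using assms by (simp add: divide_simps) (simp add: wd_def algebra_simps)
    then show ?thesis by (simp add: vec_eq_iff forall_2 mult_vec_2 A_def)
  qed
  moreover have "A *v v = y"
  proof -
    have "((x$i * v$2 - y$i * u$2) / wd u v) * v$1 + ((y$i * u$1 - x$i * v$1) / wd u v) * v$2 = y$i" for i
      using assms by (simp add: divide_simps) (simp add: wd_def algebra_simps)
    then show ?thesis by (simp add: vec_eq_iff forall_2 mult_vec_2 A_def)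
  qed
  ultimately show ?thesis by (rule that)
qed

lemma SL2_on_basis:
  assumes "wd u v \<noteq> 0" "A *v u = x" "A *v v = y" "wd x y = wd u v"
  shows "A \<in> SL2"
  using wd_mult[of A u v] assms by (simp add: SL2_def)

lemma matrix_inv_SL2:
  assumes "A \<in> SL2"
  shows "matrix_inv A ** A = mat 1" "A ** matrix_inv A = mat 1" "matrix_inv A \<in> SL2"
proof -
  have "invertible A" using assms by (simp add: SL2_def invertible_det_nz)
  then show 1: "matrix_inv A ** A = mat 1" "A ** matrix_inv A = mat 1"
    using someI_ex[of "\<lambda>A'. A ** A' = mat 1 \<and> A' ** A = mat 1"]
    unfolding invertible_def matrix_inv_def by blast+
  have "det (matrix_inv A) * det A = 1"
    using 1(1) by (metis det_I det_mul)
  then show "matrix_inv A \<in> SL2" using assms by (simp add: SL2_def)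
qed

lemma SL2_mult: "A \<in> SL2 \<Longrightarrow> B \<in> SL2 \<Longrightarrow> A ** B \<in> SL2"
  by (simp add: SL2_def det_mul)

lemma mult_matrix_inv_vec: "A \<in> SL2 \<Longrightarrow> A *v (matrix_inv A *v u) = u"
  by (simp add: matrix_vector_mul_assoc matrix_inv_SL2)

text \<open>\<open>A\<close> preserves \<open>wd\<close>, so its inverse is its adjoint with respect
  to \<open>wd\<close>.\<close>

lemma wd_matrix_inv: "A \<in> SL2 \<Longrightarrow> wd (matrix_inv A *v u) v = wd u (A *v v)"
  by (metis wd_SL2 mult_matrix_inv_vec)

section \<open>Vectors over boundary points\<close>

lemma lift_nonzero: "lift \<xi> v \<Longrightarrow> v \<noteq> 0"
  by (cases \<xi>) (auto simp: lift_def vec_eq_iff forall_2)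

lemma lift_bd_vec [simp]: "lift \<xi> (bd_vec \<xi>)"
  unfolding lift_def by (rule exI[of _ 1]) simp

lemma lift_uminus: "lift \<xi> v \<Longrightarrow> lift \<xi> (- v)"
  unfolding lift_def by (metis neg_equal_0_iff_equal scaleR_minus_left)

lemma wd_lift:
  assumes "lift \<xi> u" "lift \<eta> v"
  shows "wd u v = 0 \<longleftrightarrow> \<xi> = \<eta>"
  using assms by (cases \<xi>; cases \<eta>) (auto simp: lift_def wd_def)

lemma lift_exists:
  assumes "v \<noteq> 0"
  obtains \<xi> where "lift \<xi> v"
proof (cases "v$2 = 0")
  case True
  then have "v = (v$1) *\<^sub>R bd_vec None" "v$1 \<noteq> 0"
    using assms by (auto simp: vec_eq_iff forall_2)
  then show ?thesis using that unfolding lift_def by blast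
next
  case False
  then have "v = (v$2) *\<^sub>R bd_vec (Some (v$1 / v$2))"
    by (auto simp: vec_eq_iff forall_2)
  then show ?thesis using that False unfolding lift_def by blast
qed

lemma bd_act_fixed_iff:
  assumes "A \<in> SL2" "lift \<xi> v"
  shows "bd_act A \<xi> = \<xi> \<longleftrightarrow> wd (A *v v) v = 0"
proof -
  obtain c where c: "c \<noteq> 0" "v = c *\<^sub>R bd_vec \<xi>" using assms by (auto simp: lift_def)
  have det: "A$1$1 * A$2$2 - A$1$2 * A$2$1 = 1" using assms by (simp add: SL2_det)
  have "bd_act A \<xi> = \<xi> \<longleftrightarrow> wd (A *v bd_vec \<xi>) (bd_vec \<xi>) = 0"
  proof (cases \<xi>)
    case None then show ?thesis by (simp add: wd_def mult_vec_2)
  next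
    case (Some x)
    \<comment> \<open>Otherwise \<open>A\<close> would annihilate the vector
      \<open>(x, 1)\<close>.\<close>
    have "A$1$1 * x + A$1$2 \<noteq> 0" if "A$2$1 * x + A$2$2 = 0"
    proof
      assume "A$1$1 * x + A$1$2 = 0"
      then have 1: "A$1$2 = - (A$1$1 * x)" by simp
      have 2: "A$2$2 = - (A$2$1 * x)" using that by simp
      show False using det unfolding 1 2 by (simp add: algebra_simps)
    qed
    then show ?thesis
      using Some by (cases "A$2$1 * x + A$2$2 = 0") (auto simp: wd_def mult_vec_2 divide_simps mult.commute)
  qed
  then show ?thesis using c by (simp add: matrix_vector_mult_scaleR)
qed

lemma bd_act_fixed_eigen:
  assumes "A \<in> SL2" "lift \<xi> v" "bd_act A \<xi> = \<xi>"
  obtains k where "A *v v = k *\<^sub>R v" "k \<noteq> 0"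
proof -
  have "v \<noteq> 0" using assms lift_nonzero by blast
  have "wd v (A *v v) = 0" using assms bd_act_fixed_iff wd_swap by (metis neg_equal_0_iff_equal)
  then obtain k where k: "A *v v = k *\<^sub>R v" using wd_zero_imp_parallel \<open>v \<noteq> 0\<close> by blast
  have "matrix_inv A *v (A *v v) = v"
    using assms by (simp add: matrix_vector_mul_assoc matrix_inv_SL2)
  then have "k \<noteq> 0" using k \<open>v \<noteq> 0\<close> by auto
  then show ?thesis using k that by blast
qed

section \<open>The forms \<open>Qf\<close> and the action on \<open>H2\<close>\<close>

lemma Qf_complex: "Qf u v z = Re ((of_real (u$1) - of_real (u$2) * z) * cnj (of_real (v$1) - of_real (v$2) * z))"
  by (simp add: Qf_def power2_eq_square algebra_simps)

lemma Qf_add [simp]: "Qf (u + v) w z = Qf u w z + Qf v w z" "Qf u (v + w) z = Qf u v z + Qf u w z"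
  by (simp_all add: Qf_def algebra_simps)

lemma Qf_minus [simp]: "Qf (- u) w z = - Qf u w z" "Qf u (- w) z = - Qf u w z"
  by (simp_all add: Qf_def algebra_simps)

lemma Qf_diff [simp]: "Qf (u - v) w z = Qf u w z - Qf v w z" "Qf u (v - w) z = Qf u v z - Qf u w z"
  by (simp_all add: Qf_def algebra_simps)

lemma Qf_scaleR [simp]: "Qf (c *\<^sub>R u) w z = c * Qf u w z" "Qf u (c *\<^sub>R w) z = c * Qf u w z"
  by (simp_all add: Qf_def algebra_simps)

lemma Qf_commute: "Qf u v z = Qf v u z"
  by (simp add: Qf_def algebra_simps)

lemma Qf_self: "Qf u u z = (u$1 - u$2 * Re z)\<^sup>2 + (u$2 * Im z)\<^sup>2"
  by (simp add: Qf_def power2_eq_square algebra_simps)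

lemma Qf_self_pos:
  assumes "z \<in> H2" "u \<noteq> 0"
  shows "Qf u u z > 0"
proof (cases "u$2 = 0")
  case True
  then have "u$1 \<noteq> 0" using assms by (auto simp: vec_eq_iff forall_2)
  then show ?thesis using True by (simp add: Qf_self)
next
  case False
  then have "(u$2 * Im z)\<^sup>2 > 0" using assms by (simp add: H2_def)
  then show ?thesis by (simp add: Qf_self add_nonneg_pos)
qed

lemma geod_bd_vec: "geod p q = {z \<in> H2. Qf (bd_vec p) (bd_vec q) z = 0}"
proof (cases p; cases q)
  fix x y assume "p = Some x" "q = Some y"
  have "cmod (z - of_real ((x + y) / 2)) = \<bar>x - y\<bar> / 2 \<longleftrightarrow> Qf (bd_vec p) (bd_vec q) z = 0" for z
  proof -
    have "cmod (z - of_real ((x + y) / 2)) = \<bar>x - y\<bar> / 2 \<longleftrightarrow>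
        (cmod (z - of_real ((x + y) / 2)))\<^sup>2 = (\<bar>x - y\<bar> / 2)\<^sup>2"
      by (metis abs_ge_zero divide_nonneg_nonneg norm_ge_zero power2_eq_iff_nonneg zero_le_numeral)
    also have "\<dots> \<longleftrightarrow> (Re z - (x + y) / 2)\<^sup>2 + (Im z)\<^sup>2 = ((x - y) / 2)\<^sup>2"
      by (simp add: cmod_power2 power_divide)
    also have "\<dots> \<longleftrightarrow> Qf (bd_vec p) (bd_vec q) z = 0"
      unfolding \<open>p = _\<close> \<open>q = _\<close> Qf_def by (simp add: power2_eq_square field_simps) linarith
    finally show ?thesis .
  qed
  then show ?thesis by (simp add: \<open>p = _\<close> \<open>q = _\<close>)
qed (auto simp: Qf_def)

lemma geod_Qf:
  assumes "lift p u" "lift q v"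
  shows "geod p q = {z \<in> H2. Qf u v z = 0}"
  using assms unfolding geod_bd_vec lift_def by auto

lemma geod_commute: "geod p q = geod q p"
  by (simp add: geod_bd_vec Qf_commute)

lemma mob_Re_Im:
  assumes "A \<in> SL2" "z \<in> H2"
  shows "jac A z > 0"
    "jac A z * Im (mob A z) = Im z"
    "jac A z * Re (mob A z) = (A$1$1 * Re z + A$1$2) * (A$2$1 * Re z + A$2$2) + A$1$1 * A$2$1 * (Im z)\<^sup>2"
    "jac A z * ((Re (mob A z))\<^sup>2 + (Im (mob A z))\<^sup>2) = (A$1$1 * Re z + A$1$2)\<^sup>2 + (A$1$1 * Im z)\<^sup>2"
proof -
  have det: "A$1$1 * A$2$2 - A$1$2 * A$2$1 = 1" using assms by (simp add: SL2_det)
  show pos: "jac A z > 0"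
  proof (cases "A$2$1 = 0")
    case True
    then have "A$2$2 \<noteq> 0" using det by auto
    then show ?thesis using True by (simp add: jac_def)
  next
    case False
    then have "(A$2$1 * Im z)\<^sup>2 > 0" using assms by (simp add: H2_def)
    then show ?thesis by (simp add: jac_def add_nonneg_pos)
  qed
  have Im: "Im (mob A z) = Im z / jac A z"
  proof -
    have "A$1$1 * Im z * (A$2$1 * Re z + A$2$2) - (A$1$1 * Re z + A$1$2) * (A$2$1 * Im z)
       = (A$1$1 * A$2$2 - A$1$2 * A$2$1) * Im z" by (simp add: algebra_simps)
    then show ?thesis unfolding mob_def jac_def det by (simp add: Im_divide)
  qed
  then show "jac A z * Im (mob A z) = Im z" using pos by simp
  have Re: "Re (mob A z) = ((A$1$1 * Re z + A$1$2) * (A$2$1 * Re z + A$2$2) + A$1$1 * A$2$1 * (Im z)\<^sup>2) / jac A z"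
    unfolding mob_def jac_def by (simp add: Re_divide power2_eq_square algebra_simps)
  then show "jac A z * Re (mob A z) = (A$1$1 * Re z + A$1$2) * (A$2$1 * Re z + A$2$2) + A$1$1 * A$2$1 * (Im z)\<^sup>2"
    using pos by simp
  have "(cmod (mob A z))\<^sup>2 = ((A$1$1 * Re z + A$1$2)\<^sup>2 + (A$1$1 * Im z)\<^sup>2) / jac A z"
    unfolding mob_def jac_def norm_divide power_divide by (simp add: cmod_power2)
  then show "jac A z * ((Re (mob A z))\<^sup>2 + (Im (mob A z))\<^sup>2) = (A$1$1 * Re z + A$1$2)\<^sup>2 + (A$1$1 * Im z)\<^sup>2"
    using pos by (simp add: cmod_power2)
qed

lemma mob_H2: "A \<in> SL2 \<Longrightarrow> z \<in> H2 \<Longrightarrow> mob A z \<in> H2"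
  using mob_Re_Im(1,2)[of A z] by (simp add: H2_def) (metis zero_less_mult_pos)

lemma mob_denom_nz:
  assumes "A \<in> SL2" "z \<in> H2"
  shows "of_real (A$2$1) * z + of_real (A$2$2) \<noteq> (0::complex)"
proof
  assume "of_real (A$2$1) * z + of_real (A$2$2) = (0::complex)"
  then have "A$2$1 * Re z + A$2$2 = 0" "A$2$1 * Im z = 0"
    by (simp_all add: complex_eq_iff)
  then show False using mob_Re_Im(1)[OF assms] by (simp add: jac_def)
qed

lemma mob_mult:
  assumes "A \<in> SL2" "B \<in> SL2" "z \<in> H2"
  shows "mob (A ** B) z = mob A (mob B z)"
proof -
  let ?n = "of_real (B$1$1) * z + of_real (B$1$2) :: complex"
  let ?d = "of_real (B$2$1) * z + of_real (B$2$2) :: complex"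
  have d: "?d \<noteq> 0" by (rule mob_denom_nz[OF assms(2,3)])
  have e: "(A ** B)$i$j = A$i$1 * B$1$j + A$i$2 * B$2$j" for i j
    by (simp add: matrix_matrix_mult_def sum_2)
  have "mob A (mob B z) = ((of_real (A$1$1) * ?n + of_real (A$1$2) * ?d) / ?d) /
      ((of_real (A$2$1) * ?n + of_real (A$2$2) * ?d) / ?d)"
  proof -
    have "a * (N / D) + b = (a * N + b * D) / D" if "D \<noteq> 0" for a b N D :: complex
      using that by (simp add: field_simps)
    from this[OF d] have "a * (?n / ?d) + b = (a * ?n + b * ?d) / ?d" for a b .
    then show ?thesis unfolding mob_def by (simp only:)
  qed
  also have "\<dots> = (of_real (A$1$1) * ?n + of_real (A$1$2) * ?d) / (of_real (A$2$1) * ?n + of_real (A$2$2) * ?d)"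
    using d by simp
  also have "\<dots> = mob (A ** B) z"
    unfolding mob_def e by (simp add: algebra_simps)
  finally show ?thesis ..
qed

lemma mob_id [simp]: "mob (mat 1) z = z"
  by (simp add: mob_def mat_def)

lemma mob_inv:
  assumes "A \<in> SL2" "z \<in> H2"
  shows "mob A (mob (matrix_inv A) z) = z"
  using mob_mult[OF assms(1) matrix_inv_SL2(3)[OF assms(1)] assms(2)] matrix_inv_SL2(2)[OF assms(1)]
  by simp

text \<open>For determinant 1, moving both \<open>u\<close> and \<open>z\<close> by \<open>A\<close>
  divides the linear factor \<open>u$1 - u$2 * z\<close> by the denominator of
  \<open>mob A z\<close>; multiplying by a conjugate factor brings in
  \<open>jac A z\<close>.\<close>

lemma Qf_mob:
  assumes "A \<in> SL2" "z \<in> H2"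
  shows "jac A z * Qf (A *v u) (A *v v) (mob A z) = Qf u v z"
proof -
  let ?d = "of_real (A$2$1) * z + of_real (A$2$2) :: complex"
  have d: "?d \<noteq> 0" by (rule mob_denom_nz[OF assms])
  have "A$1$1 * A$2$2 - A$1$2 * A$2$1 = 1" using assms by (simp add: SL2_det)
  then have det: "of_real (A$1$1) * of_real (A$2$2) - of_real (A$1$2) * of_real (A$2$1) = (1::complex)"
    by (metis of_real_1 of_real_diff of_real_mult)
  have u: "of_real ((A *v u)$1) - of_real ((A *v u)$2) * mob A z = (of_real (u$1) - of_real (u$2) * z) / ?d" for u
  proof -
    have "of_real ((A *v u)$1) * ?d - of_real ((A *v u)$2) * (of_real (A$1$1) * z + of_real (A$1$2))
       = (of_real (A$1$1) * of_real (A$2$2) - of_real (A$1$2) * of_real (A$2$1)) * (of_real (u$1) - of_real (u$2) * z)"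
      by (simp add: mult_vec_2 algebra_simps)
    then have "of_real ((A *v u)$1) * ?d - of_real ((A *v u)$2) * (of_real (A$1$1) * z + of_real (A$1$2))
       = of_real (u$1) - of_real (u$2) * z" by (simp add: det)
    moreover have "of_real ((A *v u)$1) - of_real ((A *v u)$2) * mob A z =
        (of_real ((A *v u)$1) * ?d - of_real ((A *v u)$2) * (of_real (A$1$1) * z + of_real (A$1$2))) / ?d"
      unfolding mob_def using d by (simp only: diff_divide_distrib times_divide_eq_right nonzero_mult_div_cancel_right not_False_eq_True)
    ultimately show ?thesis by (simp only:)
  qed
  have j: "of_real (jac A z) = ?d * cnj ?d"
    by (simp add: jac_def complex_eq_iff power2_eq_square)
  have c: "(?d * cnj ?d) * (U / ?d * cnj (V / ?d)) = U * cnj V" for U V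
  proof -
    have "(D * cnj D) * (U / D * cnj (V / D)) = U * cnj V" if "D \<noteq> 0" for D
      using that by (simp add: field_simps)
    from this[OF d] show ?thesis .
  qed
  let ?w = "(of_real ((A *v u)$1) - of_real ((A *v u)$2) * mob A z)
      * cnj (of_real ((A *v v)$1) - of_real ((A *v v)$2) * mob A z)"
  have "jac A z * Re ?w = Re (of_real (jac A z) * ?w)" by simp
  also have "of_real (jac A z) * ?w = (of_real (u$1) - of_real (u$2) * z) * cnj (of_real (v$1) - of_real (v$2) * z)"
    unfolding u j c ..
  finally show ?thesis by (simp add: Qf_complex)
qed

lemma Qf_mob_inv:
  assumes "A \<in> SL2" "z \<in> H2"
  shows "jac A z * Qf u v (mob A z) = Qf (matrix_inv A *v u) (matrix_inv A *v v) z"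
  using Qf_mob[OF assms, of "matrix_inv A *v u" "matrix_inv A *v v"]
  unfolding mult_matrix_inv_vec[OF assms(1)] .

subsection \<open>Geodesics and their sides\<close>

text \<open>A positive combination of the squares of two independent linear forms is positive
  definite, and positive definite forms up to scale are the points of \<open>H2\<close>. For
  \<open>a = u\<close>, \<open>b = v\<close> the right-hand side is 0, so the point lies on the
  geodesic of \<open>u\<close> and \<open>v\<close>.\<close>

lemma geod_point_exists:
  assumes "wd u v \<noteq> 0" "s > 0" "t > 0"
  obtains z k where "z \<in> H2" "k > 0"
    "\<And>a b. k * Qf a b z = s * (wd a u * wd b u) + t * (wd a v * wd b v)"
proof -
  \<comment> \<open>\<open>X\<close>, \<open>- Y\<close> and \<open>W\<close> are the coefficients
    of the form; its point has real part \<open>Y / W\<close> and squared modulus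
    \<open>X / W\<close>.\<close>
  define W where "W = s * (u$2)\<^sup>2 + t * (v$2)\<^sup>2"
  define Y where "Y = s * (u$1 * u$2) + t * (v$1 * v$2)"
  define X where "X = s * (u$1)\<^sup>2 + t * (v$1)\<^sup>2"
  have disc: "X * W - Y\<^sup>2 = s * t * (wd u v)\<^sup>2"
    by (simp add: X_def Y_def W_def wd_def power2_eq_square algebra_simps)
  then have disc_pos: "X * W - Y\<^sup>2 > 0" using assms by simp
  have "W \<ge> 0" using assms by (simp add: W_def)
  moreover have "W \<noteq> 0"
  proof
    assume "W = 0"
    then show False using disc_pos by simp
  qed
  ultimately have W: "W > 0" by simp
  define z where "z = Complex (Y / W) (sqrt (X * W - Y\<^sup>2) / W)"
  have z: "z \<in> H2" using W disc_pos by (simp add: H2_def z_def)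
  have "(Re z)\<^sup>2 + (Im z)\<^sup>2 = X / W"
    using W disc_pos by (simp add: z_def power_divide field_simps power2_eq_square)
  then have abs: "W * ((Re z)\<^sup>2 + (Im z)\<^sup>2) = X" using W by simp
  have re: "W * Re z = Y" using W by (simp add: z_def)
  have "W * Qf a b z = s * (wd a u * wd b u) + t * (wd a v * wd b v)" for a b
  proof -
    have "W * Qf a b z = a$1 * b$1 * W - (a$1 * b$2 + a$2 * b$1) * (W * Re z)
        + a$2 * b$2 * (W * ((Re z)\<^sup>2 + (Im z)\<^sup>2))"
      by (simp add: Qf_def algebra_simps)
    also have "\<dots> = s * (wd a u * wd b u) + t * (wd a v * wd b v)"
      unfolding re abs by (simp add: X_def Y_def W_def wd_def power2_eq_square algebra_simps)
    finally show ?thesis .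
  qed
  then show ?thesis using that z W by blast
qed

text \<open>Converse of \<open>geod_point_exists\<close>: on the geodesic \<open>u\<close> and
  \<open>v\<close> are orthogonal for the form given by \<open>z\<close>, which is therefore
  diagonal in this basis.\<close>

lemma geod_point_decomp:
  assumes "wd u v \<noteq> 0" "z \<in> H2" "Qf u v z = 0"
  obtains s t where "s > 0" "t > 0"
    "\<And>a b. Qf a b z = s * (wd a u * wd b u) + t * (wd a v * wd b v)"
proof
  have nz: "u \<noteq> 0" "v \<noteq> 0" using assms(1) by auto
  let ?D = "(wd u v)\<^sup>2"
  have D: "?D > 0" using assms(1) by simp
  show "Qf v v z / ?D > 0" "Qf u u z / ?D > 0"
    using Qf_self_pos[OF assms(2)] nz D by simp_all
  fix a b
  obtain a1 a2 where a: "a = a1 *\<^sub>R u + a2 *\<^sub>R v" using wd_basis[OF assms(1)] .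
  obtain b1 b2 where b: "b = b1 *\<^sub>R u + b2 *\<^sub>R v" using wd_basis[OF assms(1)] .
  have "Qf a b z = a1 * b1 * Qf u u z + a2 * b2 * Qf v v z"
    using assms(3) by (simp add: a b Qf_commute[of v u] algebra_simps)
  then show "Qf a b z = Qf v v z / ?D * (wd a u * wd b u) + Qf u u z / ?D * (wd a v * wd b v)"
    using assms(1) by (simp add: a b wd_swap[of v u] power2_eq_square algebra_simps)
qed

lemma pos_combination_zero:
  fixes x y :: real
  assumes "\<And>s t. s > 0 \<Longrightarrow> t > 0 \<Longrightarrow> s * x + t * y \<ge> 0"
  shows "x \<ge> 0" "y \<ge> 0"
proof -
  have "x \<ge> 0" if "\<And>s t. s > 0 \<Longrightarrow> t > 0 \<Longrightarrow> s * x + t * y \<ge> 0" for x y :: real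
  proof (rule ccontr)
    assume "\<not> x \<ge> 0"
    \<comment> \<open>With this weight on \<open>x\<close> and weight 1 on \<open>y\<close> the sum
      is \<open>y - |y| - 1\<close>, which is negative.\<close>
    then have "(\<bar>y\<bar> + 1) / - x > 0" by (intro divide_pos_pos) auto
    from that[OF this, of 1] \<open>\<not> x \<ge> 0\<close> show False by simp
  qed
  note * = this
  show "x \<ge> 0" by (rule *[of x y]) (rule assms)
  show "y \<ge> 0"
  proof (rule *[of y x])
    fix s t :: real assume "s > 0" "t > 0"
    then show "s * y + t * x \<ge> 0" using assms[of t s] by linarith
  qed
qed

text \<open>The form of the second pair of endpoints vanishes along the first geodesic, hence for
  all positive weights; so both coefficients are 0, and each of \<open>p\<close>, \<open>q\<close>
  is one of \<open>p'\<close>, \<open>q'\<close>.\<close>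

lemma geod_endpoints:
  assumes "geod p q = geod p' q'" "p \<noteq> q" "p' \<noteq> q'"
  shows "{p, q} = {p', q'}"
proof -
  let ?u = "bd_vec p" let ?v = "bd_vec q" let ?x = "bd_vec p'" let ?y = "bd_vec q'"
  have nz: "wd ?u ?v \<noteq> 0" using assms wd_lift[OF lift_bd_vec lift_bd_vec] by blast
  have 0: "s * (wd ?x ?u * wd ?y ?u) + t * (wd ?x ?v * wd ?y ?v) = 0" if st: "s > 0" "t > 0" for s t
  proof -
    obtain z k where z: "z \<in> H2" "k > 0"
      "\<And>a b. k * Qf a b z = s * (wd a ?u * wd b ?u) + t * (wd a ?v * wd b ?v)"
      using geod_point_exists[OF nz st] by blast
    have "k * Qf ?u ?v z = 0" unfolding z(3) by simp
    then have "z \<in> geod p q" using z(1,2) by (simp add: geod_bd_vec)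
    then have "Qf ?x ?y z = 0" unfolding assms(1) by (simp add: geod_bd_vec)
    then show ?thesis using z(3)[of ?x ?y] by simp
  qed
  have "wd ?x ?u * wd ?y ?u \<ge> 0 \<and> wd ?x ?v * wd ?y ?v \<ge> 0"
    using pos_combination_zero[of "wd ?x ?u * wd ?y ?u" "wd ?x ?v * wd ?y ?v"] 0 by simp
  moreover have "- (wd ?x ?u * wd ?y ?u) \<ge> 0 \<and> - (wd ?x ?v * wd ?y ?v) \<ge> 0"
  proof -
    have "s * - (wd ?x ?u * wd ?y ?u) + t * - (wd ?x ?v * wd ?y ?v) \<ge> 0" if "s > 0" "t > 0" for s t
      using 0[OF that] by simp
    then show ?thesis
      using pos_combination_zero[of "- (wd ?x ?u * wd ?y ?u)" "- (wd ?x ?v * wd ?y ?v)"] by blast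
  qed
  ultimately have "wd ?x ?u * wd ?y ?u = 0" "wd ?x ?v * wd ?y ?v = 0" by linarith+
  then have "p' = p \<or> q' = p" "p' = q \<or> q' = q"
    using wd_lift[OF lift_bd_vec lift_bd_vec] by simp_all
  then show ?thesis using assms by blast
qed

lemma ends_geod:
  assumes "p \<noteq> q"
  shows "ends (geod p q) = {p, q}"
proof -
  have "\<xi> \<in> {p, q}" if "\<xi> \<in> ends (geod p q)" for \<xi>
    using that geod_endpoints[of p q \<xi>] assms unfolding ends_def by blast
  moreover have "p \<in> ends (geod p q)" "q \<in> ends (geod p q)"
    unfolding ends_def using assms geod_commute[of q p] by auto
  ultimately show ?thesis by blast
qed

section \<open>The two sides of a geodesic\<close>

lemma continuous_on_Qf [continuous_intros]: "continuous_on A (Qf u v)"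
  unfolding Qf_def by (intro continuous_intros)

lemma open_H2: "open H2"
  unfolding H2_def by (simp add: open_halfspace_Im_gt)

text \<open>In the coordinates \<open>(|z|\<^sup>2, Re z)\<close> both \<^const>\<open>H2\<close> and the form \<^term>\<open>Qf u v\<close> become convex.\<close>
lemma connected_Qf_pos: "connected {z \<in> H2. Qf u v z > 0}"
proof -
  define K :: "(real \<times> real) set" where
    "K = {w. (snd w)\<^sup>2 < fst w \<and> u$1 * v$1 - (u$1 * v$2 + u$2 * v$1) * snd w + u$2 * v$2 * fst w > 0}"
  have "convex K"
  proof (rule convexI)
    fix x y :: "real \<times> real" and s t :: real
    assume xy: "x \<in> K" "y \<in> K" and st: "0 \<le> s" "0 \<le> t" "s + t = 1"
    let ?l = "\<lambda>w :: real \<times> real. u$1 * v$1 - (u$1 * v$2 + u$2 * v$1) * snd w + u$2 * v$2 * fst w"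
    have pos: "s * X + t * Y > 0" if "X > 0" "Y > 0" for X Y :: real
    proof (cases "s = 0")
      case False
      then show ?thesis using that st by (intro add_pos_nonneg mult_pos_pos mult_nonneg_nonneg) auto
    qed (use that st in auto)
    have "?l (s *\<^sub>R x + t *\<^sub>R y) = s * ?l x + t * ?l y + (1 - (s + t)) * (u$1 * v$1)"
      by (simp add: algebra_simps)
    then have "?l (s *\<^sub>R x + t *\<^sub>R y) > 0"
      using pos[of "?l x" "?l y"] xy st by (simp add: K_def)
    moreover have "(s * snd x + t * snd y)\<^sup>2 < s * fst x + t * fst y"
    proof -
      have t: "t = 1 - s" using st by simp
      have "s * (snd x)\<^sup>2 + t * (snd y)\<^sup>2 - (s * snd x + t * snd y)\<^sup>2 = s * t * (snd x - snd y)\<^sup>2"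
        unfolding t by (simp add: power2_eq_square algebra_simps)
      moreover have "s * t * (snd x - snd y)\<^sup>2 \<ge> 0" using st by simp
      ultimately have "(s * snd x + t * snd y)\<^sup>2 \<le> s * (snd x)\<^sup>2 + t * (snd y)\<^sup>2" by linarith
      moreover have "s * (fst x - (snd x)\<^sup>2) + t * (fst y - (snd y)\<^sup>2) > 0"
        using xy by (intro pos) (simp_all add: K_def)
      ultimately show ?thesis by (simp add: algebra_simps)
    qed
    ultimately show "s *\<^sub>R x + t *\<^sub>R y \<in> K" by (simp add: K_def)
  qed
  then have K: "connected K" by (rule convex_connected)
  define f where "f = (\<lambda>w :: real \<times> real. Complex (snd w) (sqrt (fst w - (snd w)\<^sup>2)))"
  have "continuous_on K f"
    unfolding f_def Complex_eq by (intro continuous_intros)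
  then have "connected (f ` K)" using K by (rule connected_continuous_image)
  moreover have "f ` K = {z \<in> H2. Qf u v z > 0}"
  proof (intro equalityI subsetI)
    fix z assume "z \<in> f ` K"
    then show "z \<in> {z \<in> H2. Qf u v z > 0}"
      by (auto simp: f_def K_def H2_def Qf_def)
  next
    fix z assume z: "z \<in> {z \<in> H2. Qf u v z > 0}"
    then have "z = f ((Re z)\<^sup>2 + (Im z)\<^sup>2, Re z)"
      by (simp add: f_def H2_def complex_eq_iff)
    moreover have "((Re z)\<^sup>2 + (Im z)\<^sup>2, Re z) \<in> K"
      using z by (simp add: K_def H2_def Qf_def)
    ultimately show "z \<in> f ` K" by blast
  qed
  ultimately show ?thesis by simp
qed

text \<open>A component that meets the positive part contains all of it, hence meets
  \<open>M\<close>. A component that meets the negative part stays in it, because the two parts are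
  open and disjoint.\<close>

lemma away_geod:
  assumes "lift p u" "lift q v" "M \<noteq> {}" "M \<subseteq> {z \<in> H2. Qf u v z > 0}"
  shows "away (geod p q) M = {z \<in> H2. Qf u v z < 0}"
proof -
  let ?N = "{z \<in> H2. Qf u v z < 0}" and ?P = "{z \<in> H2. Qf u v z > 0}"
  let ?S = "H2 - geod p q"
  have S: "?S = ?N \<union> ?P" using assms by (auto simp: geod_Qf)
  have op: "open ?N" "open ?P"
  proof -
    have "?N = H2 \<inter> (Qf u v) -` {..<0}" "?P = H2 \<inter> (Qf u v) -` {0<..}" by auto
    then show "open ?N" "open ?P"
      using continuous_open_preimage[OF continuous_on_Qf open_H2] by (metis open_lessThan, metis open_greaterThan)
  qed
  show ?thesis
  proof (intro equalityI subsetI)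
    fix z assume "z \<in> away (geod p q) M"
    then obtain C where C: "C \<in> components ?S" "C \<inter> M = {}" "z \<in> C" by (auto simp: away_def)
    have "z \<notin> ?P"
    proof
      assume "z \<in> ?P"
      then have "?P \<subseteq> C"
        using components_maximal[OF C(1) connected_Qf_pos[of u v]] C(3) S by blast
      then show False using C(2) assms by blast
    qed
    then show "z \<in> ?N" using C in_components_subset S by blast
  next
    fix z assume z: "z \<in> ?N"
    let ?C = "connected_component_set ?S z"
    have zS: "z \<in> ?S" using z S by blast
    then have zC: "z \<in> ?C" by simp
    have "?C \<inter> ?P = {}"
    proof (rule ccontr)
      assume "?C \<inter> ?P \<noteq> {}"
      moreover have "connected ?C" by (rule connected_connected_component)
      moreover have "?C \<subseteq> ?N \<union> ?P" using connected_component_subset S by metis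
      moreover have "?N \<inter> ?P \<inter> ?C = {}" by auto
      ultimately have "?N \<inter> ?C = {}"
        using connectedD[of ?C ?N ?P] op by blast
      then show False using z zC by blast
    qed
    then have "?C \<inter> M = {}" using assms by blast
    then show "z \<in> away (geod p q) M"
      unfolding away_def using zC componentsI[OF zS] by blast
  qed
qed

lemma geod_nonempty:
  assumes "p \<noteq> q"
  shows "geod p q \<noteq> {}"
proof -
  let ?u = "bd_vec p" let ?v = "bd_vec q"
  have nz: "wd ?u ?v \<noteq> 0" using assms wd_lift[OF lift_bd_vec lift_bd_vec] by blast
  have "geod p q \<noteq> {}" if st: "s > 0" "t > 0" for s t :: real
  proof -
    obtain z k where z: "z \<in> H2" "k > 0"
      "\<And>a b. k * Qf a b z = s * (wd a ?u * wd b ?u) + t * (wd a ?v * wd b ?v)"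
      using geod_point_exists[OF nz st] by blast
    have "k * Qf ?u ?v z = 0" unfolding z(3) by simp
    then have "z \<in> geod p q" using z(1,2) by (simp add: geod_bd_vec)
    then show ?thesis by blast
  qed
  from this[OF zero_less_one zero_less_one] show ?thesis .
qed

subsection \<open>Stem quadrants\<close>

text \<open>The right-hand side says that the two pairs of endpoints are harmonic (cross-ratio -1).
  For finite endpoints the two circle equations eliminate \<open>z\<close> from the scalar product
  of the tangents; homogeneity carries the result over to all lifts.\<close>

lemma gtan_orthogonal_iff:
  assumes "p \<noteq> q" "p' \<noteq> q'" "z \<in> geod p q" "z \<in> geod p' q'"
    and "lift p u" "lift q v" "lift p' x" "lift q' y"
  shows "Re (gtan p q z * cnj (gtan p' q' z)) = 0 \<longleftrightarrow> wd x u * wd y v + wd x v * wd y u = 0"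
proof -
  let ?h = "\<lambda>u v x y. wd x u * wd y v + wd x v * wd y u"
  let ?u = "bd_vec p" let ?v = "bd_vec q" let ?x = "bd_vec p'" let ?y = "bd_vec q'"
  have Q: "Qf ?u ?v z = 0" "Qf ?x ?y z = 0" using assms(3,4) by (simp_all add: geod_bd_vec)
  have "Re (gtan p q z * cnj (gtan p' q' z)) = 0 \<longleftrightarrow> ?h ?u ?v ?x ?y = 0"
  proof (cases p; cases q; cases p'; cases q')
    fix a b c d assume s: "p = Some a" "q = Some b" "p' = Some c" "q' = Some d"
    have 1: "a * b - (a + b) * Re z + ((Re z)\<^sup>2 + (Im z)\<^sup>2) = 0"
      and 2: "c * d - (c + d) * Re z + ((Re z)\<^sup>2 + (Im z)\<^sup>2) = 0"
      using Q by (simp_all add: s Qf_def)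
    have "2 * Re (gtan p q z * cnj (gtan p' q' z)) = 2 * ((Re z)\<^sup>2 + (Im z)\<^sup>2) - (a + b + c + d) * Re z + (a + b) * (c + d) / 2"
      by (simp add: s power2_eq_square field_simps)
    also have "\<dots> = ((a + b) * (c + d) / 2 - a * b - c * d)
        + (a * b - (a + b) * Re z + ((Re z)\<^sup>2 + (Im z)\<^sup>2)) + (c * d - (c + d) * Re z + ((Re z)\<^sup>2 + (Im z)\<^sup>2))"
      by (simp add: algebra_simps)
    also have "\<dots> = (a + b) * (c + d) / 2 - a * b - c * d"
      unfolding 1 2 by simp
    also have "\<dots> = - ?h ?u ?v ?x ?y / 2"
      by (simp add: s wd_def field_simps)
    finally show ?thesis by auto
  next
    fix a b c assume s: "p = Some a" "q = Some b" "p' = Some c" "q' = None"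
    have "Re z = c" using Q by (simp add: s Qf_def)
    then show ?thesis by (simp add: s wd_def) linarith
  next
    fix a b c assume s: "p = Some a" "q = Some b" "p' = None" "q' = Some c"
    have "Re z = c" using Q by (simp add: s Qf_def)
    then show ?thesis by (simp add: s wd_def) linarith
  next
    fix a b c assume s: "p = Some a" "q = None" "p' = Some b" "q' = Some c"
    have "Re z = a" using Q by (simp add: s Qf_def)
    then show ?thesis by (simp add: s wd_def) linarith
  next
    fix a b c assume s: "p = None" "q = Some a" "p' = Some b" "q' = Some c"
    have "Re z = a" using Q by (simp add: s Qf_def)
    then show ?thesis by (simp add: s wd_def) linarith
  qed (use assms(1,2) in \<open>auto simp: wd_def\<close>)
  also have "\<dots> \<longleftrightarrow> ?h u v x y = 0"
  proof -
    obtain a b c d where "u = a *\<^sub>R ?u" "v = b *\<^sub>R ?v" "x = c *\<^sub>R ?x" "y = d *\<^sub>R ?y"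
      "a \<noteq> 0" "b \<noteq> 0" "c \<noteq> 0" "d \<noteq> 0" using assms(5-8) unfolding lift_def by metis
    moreover from this have "?h u v x y = a * b * c * d * ?h ?u ?v ?x ?y"
      by (simp add: algebra_simps)
    ultimately show ?thesis by (metis mult_eq_0_iff)
  qed
  finally show ?thesis .
qed

lemma orthogonal_geods_iff:
  assumes "p \<noteq> q" "p' \<noteq> q'" "lift p u" "lift q v" "lift p' x" "lift q' y"
  shows "orthogonal_geods (geod p' q') (geod p q) \<longleftrightarrow>
    geod p' q' \<inter> geod p q \<noteq> {} \<and> wd x u * wd y v + wd x v * wd y u = 0"
proof
  assume "orthogonal_geods (geod p' q') (geod p q)"
  then obtain a b c d z where o: "a \<noteq> b" "c \<noteq> d" "geod p' q' = geod a b" "geod p q = geod c d"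
    "z \<in> geod p' q'" "z \<in> geod p q" "Re (gtan a b z * cnj (gtan c d z)) = 0"
    unfolding orthogonal_geods_def by blast
  have ab: "a = p' \<and> b = q' \<or> a = q' \<and> b = p'"
    using geod_endpoints[OF o(3) assms(2) o(1)] by (auto simp: doubleton_eq_iff)
  have cd: "c = p \<and> d = q \<or> c = q \<and> d = p"
    using geod_endpoints[OF o(4) assms(1) o(2)] by (auto simp: doubleton_eq_iff)
  obtain x' y' where xy: "lift a x'" "lift b y'" "x' = x \<and> y' = y \<or> x' = y \<and> y' = x"
    using ab assms(5,6) by blast
  obtain u' v' where uv: "lift c u'" "lift d v'" "u' = u \<and> v' = v \<or> u' = v \<and> v' = u"
    using cd assms(3,4) by blast
  have "wd u' x' * wd v' y' + wd u' y' * wd v' x' = 0"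
    using gtan_orthogonal_iff[OF o(1,2) _ _ xy(1,2) uv(1,2)] o by blast
  then have "wd x u * wd y v + wd x v * wd y u = 0"
    using xy(3) uv(3) wd_swap[of u x] wd_swap[of u y] wd_swap[of v x] wd_swap[of v y]
    by (elim disjE conjE) (simp_all add: algebra_simps)
  then show "geod p' q' \<inter> geod p q \<noteq> {} \<and> wd x u * wd y v + wd x v * wd y u = 0"
    using o(5,6) by blast
next
  assume r: "geod p' q' \<inter> geod p q \<noteq> {} \<and> wd x u * wd y v + wd x v * wd y u = 0"
  then obtain z where z: "z \<in> geod p' q'" "z \<in> geod p q" by blast
  have "wd u x * wd v y + wd u y * wd v x = 0"
    using r wd_swap[of u x] wd_swap[of u y] wd_swap[of v x] wd_swap[of v y]
    by (simp add: algebra_simps)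
  then have "Re (gtan p' q' z * cnj (gtan p q z)) = 0"
    using gtan_orthogonal_iff[OF assms(2,1) z assms(5,6,3,4)] by blast
  then show "orthogonal_geods (geod p' q') (geod p q)"
    unfolding orthogonal_geods_def using assms(1,2) z by blast
qed

text \<open>In the basis \<open>u\<close>, \<open>v\<close> the inverse is the adjugate
  matrix.\<close>

lemma SL2_inv_on_basis:
  assumes "A \<in> SL2" "wd u v \<noteq> 0" "A *v u = c *\<^sub>R u + a *\<^sub>R v" "A *v v = b *\<^sub>R u + d *\<^sub>R v"
  shows "c * d - a * b = 1" "matrix_inv A *v u = d *\<^sub>R u - a *\<^sub>R v" "matrix_inv A *v v = c *\<^sub>R v - b *\<^sub>R u"
proof -
  have "(c * d - a * b) * wd u v = wd (A *v u) (A *v v)"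
    unfolding assms(3,4) by (simp add: wd_swap[of v u] algebra_simps)
  then show 1: "c * d - a * b = 1" using wd_SL2[OF assms(1)] assms(2) by simp
  have inv: "matrix_inv A *v (A *v x) = x" for x
    using assms(1) by (simp add: matrix_vector_mul_assoc matrix_inv_SL2)
  have "A *v (d *\<^sub>R u - a *\<^sub>R v) = (c * d - a * b) *\<^sub>R u"
    by (simp add: matrix_vector_mult_diff_distrib matrix_vector_mult_scaleR assms(3,4) algebra_simps)
  then show "matrix_inv A *v u = d *\<^sub>R u - a *\<^sub>R v" using inv[of "d *\<^sub>R u - a *\<^sub>R v"] 1 by simp
  have "A *v (c *\<^sub>R v - b *\<^sub>R u) = (c * d - a * b) *\<^sub>R v"
    by (simp add: matrix_vector_mult_diff_distrib matrix_vector_mult_scaleR assms(3,4) algebra_simps)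
  then show "matrix_inv A *v v = c *\<^sub>R v - b *\<^sub>R u" using inv[of "c *\<^sub>R v - b *\<^sub>R u"] 1 by simp
qed

lemma is_id_scalar:
  assumes "A \<in> SL2" "wd u v \<noteq> 0" "A *v u = c *\<^sub>R u" "A *v v = c *\<^sub>R v"
  shows "is_id A"
proof -
  have "c * c = 1" using SL2_inv_on_basis(1)[of A u v c 0 0 c] assms by simp
  then have "c = 1 \<or> c = -1" by (metis power2_eq_1_iff power2_eq_square)
  moreover have "A = c *\<^sub>R mat 1"
    by (rule mat_eq_on_basis[OF assms(2)])
      (simp_all add: assms scaleR_matrix_vector_assoc[symmetric])
  ultimately show ?thesis by (auto simp: is_id_def)
qed

text \<open>If \<open>c * a\<close> and \<open>c * b\<close> have the same sign, it decides to which
  side a point of the geodesic is moved.\<close>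

lemma Qf_mob_orthogonal:
  assumes "A \<in> SL2" "wd u v \<noteq> 0" "A *v u = c *\<^sub>R u + a *\<^sub>R v" "A *v v = b *\<^sub>R u + c *\<^sub>R v"
    and "z \<in> H2" "Qf u v z = 0"
  shows "jac A z * Qf u v (mob A z) = - (c * b * Qf u u z + c * a * Qf v v z)"
  unfolding Qf_mob_inv[OF assms(1,5)] SL2_inv_on_basis(2,3)[OF assms(1-4)]
  using assms(6) by (simp add: Qf_commute[of v u] algebra_simps)

text \<open>Equal diagonal entries place the fixed points symmetrically in the basis
  \<open>u\<close>, \<open>v\<close>, so they are harmonic to the endpoints and the axis is
  orthogonal. The conditions \<open>c * a > 0\<close> and \<open>c * b > 0\<close> direct the
  translation to the side where \<open>Qf u v\<close> is negative.\<close>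

lemma SQ_geodI:
  assumes "p \<noteq> q" "lift p u" "lift q v" "A \<in> SL2"
    and "A *v u = c *\<^sub>R u + a *\<^sub>R v" "A *v v = b *\<^sub>R u + c *\<^sub>R v" "c * a > 0" "c * b > 0"
  shows "A \<in> SQ (geod p q) {z \<in> H2. Qf u v z < 0}"
proof -
  have nz: "wd u v \<noteq> 0" using assms wd_lift by blast
  have ab: "a \<noteq> 0" "b \<noteq> 0" "\<bar>a\<bar> > 0" "\<bar>b\<bar> > 0" "b * \<bar>a\<bar> = a * \<bar>b\<bar>"
    using assms(7,8) by (auto simp: abs_if zero_less_mult_iff)
  \<comment> \<open>\<open>s u + t v\<close> is an eigenvector when
    \<open>b * (t * t) = a * (s * s)\<close>, and \<open>a\<close> and \<open>b\<close> have the
    same sign.\<close>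
  define x where "x = sqrt \<bar>b\<bar> *\<^sub>R u + sqrt \<bar>a\<bar> *\<^sub>R v"
  define y where "y = sqrt \<bar>b\<bar> *\<^sub>R u - sqrt \<bar>a\<bar> *\<^sub>R v"
  have xy: "wd x y \<noteq> 0"
  proof -
    have "wd x y = - 2 * (sqrt \<bar>b\<bar> * sqrt \<bar>a\<bar>) * wd u v"
      by (simp add: x_def y_def wd_swap[of v u] algebra_simps)
    then show ?thesis using nz ab by simp
  qed
  then have "x \<noteq> 0" "y \<noteq> 0" by auto
  then obtain \<xi> \<eta> where le: "lift \<xi> x" "lift \<eta> y" using lift_exists by metis
  have ne: "\<xi> \<noteq> \<eta>" using xy wd_lift[OF le] by blast
  have sq: "sqrt \<bar>b\<bar> * sqrt \<bar>b\<bar> = \<bar>b\<bar>" "sqrt \<bar>a\<bar> * sqrt \<bar>a\<bar> = \<bar>a\<bar>" by simp_all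
  have Ac: "A *v (s *\<^sub>R u + t *\<^sub>R v) = (c * s + b * t) *\<^sub>R u + (a * s + c * t) *\<^sub>R v" for s t
    by (simp add: matrix_vector_right_distrib matrix_vector_mult_scaleR assms(5,6) algebra_simps)
  have fx: "wd (A *v (s *\<^sub>R u + t *\<^sub>R v)) (s *\<^sub>R u + t *\<^sub>R v) = (b * (t * t) - a * (s * s)) * wd u v" for s t
    unfolding Ac by (simp add: wd_swap[of v u] algebra_simps)
  have "wd (A *v x) x = 0" "wd (A *v y) y = 0"
    using fx[of "sqrt \<bar>b\<bar>" "sqrt \<bar>a\<bar>"] fx[of "sqrt \<bar>b\<bar>" "- sqrt \<bar>a\<bar>"] ab(5)
    by (simp_all add: x_def y_def sq)
  then have fp: "bd_act A \<xi> = \<xi>" "bd_act A \<eta> = \<eta>"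
    using bd_act_fixed_iff[OF assms(4)] le by blast+
  have "\<not> is_id A"
  proof
    assume "is_id A"
    then have "A *v u = u \<or> A *v u = - u" unfolding is_id_def by (auto simp: vec_eq_iff forall_2 mult_vec_2 mat_def)
    then have "wd u (A *v u) = 0" by auto
    then show False using ab nz by (simp add: assms(5))
  qed
  then have hyp: "hyperbolic A" unfolding hyperbolic_def using fp ne by blast
  have "trans_axis A (geod \<xi> \<eta>)" unfolding trans_axis_def using hyp ne fp by blast
  moreover have "orthogonal_geods (geod \<xi> \<eta>) (geod p q)"
  proof -
    \<comment> \<open>These weights give the crossing point: the resulting form vanishes on the pair
      \<open>u\<close>, \<open>v\<close> and on the pair \<open>x\<close>, \<open>y\<close>.\<close>
    obtain z k where z: "z \<in> H2" "k > 0"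
      "\<And>d e. k * Qf d e z = \<bar>b\<bar> * (wd d u * wd e u) + \<bar>a\<bar> * (wd d v * wd e v)"
      using geod_point_exists[OF nz ab(4,3)] by blast
    have "k * Qf u v z = 0" unfolding z(3) by simp
    then have "z \<in> geod p q" using z(1,2) by (simp add: geod_Qf[OF assms(2,3)])
    moreover have "z \<in> geod \<xi> \<eta>"
    proof -
      have wu: "wd x u = - (sqrt \<bar>a\<bar> * wd u v)" "wd y u = sqrt \<bar>a\<bar> * wd u v"
        "wd x v = sqrt \<bar>b\<bar> * wd u v" "wd y v = sqrt \<bar>b\<bar> * wd u v"
        by (simp_all add: x_def y_def wd_swap[of v u])
      have "k * Qf x y z = (- \<bar>b\<bar> * (sqrt \<bar>a\<bar> * sqrt \<bar>a\<bar>) + \<bar>a\<bar> * (sqrt \<bar>b\<bar> * sqrt \<bar>b\<bar>)) * (wd u v)\<^sup>2"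
        unfolding z(3) wu by (simp add: algebra_simps power2_eq_square)
      then have "k * Qf x y z = 0" unfolding sq by simp
      then show ?thesis using z(1,2) by (simp add: geod_Qf[OF le])
    qed
    moreover have "wd x u * wd y v + wd x v * wd y u = 0"
      by (simp add: x_def y_def wd_swap[of v u] algebra_simps)
    ultimately show ?thesis
      using orthogonal_geods_iff[OF assms(1) ne assms(2,3) le] by blast
  qed
  moreover have "mob A z \<in> {z \<in> H2. Qf u v z < 0}" if "z \<in> geod \<xi> \<eta> \<inter> geod p q" for z
  proof -
    have z: "z \<in> H2" "Qf u v z = 0" using that by (auto simp: geod_Qf[OF assms(2,3)])
    have "u \<noteq> 0" "v \<noteq> 0" using nz by auto
    then have "c * b * Qf u u z + c * a * Qf v v z > 0"
      using assms(7,8) Qf_self_pos[OF z(1)] by (simp add: add_pos_pos)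
    then have "jac A z * Qf u v (mob A z) < 0"
      using Qf_mob_orthogonal[OF assms(4) nz assms(5,6) z] by linarith
    then have "Qf u v (mob A z) < 0"
      using mob_Re_Im(1)[OF assms(4) z(1)] by (simp add: mult_less_0_iff)
    then show ?thesis using mob_H2[OF assms(4) z(1)] by blast
  qed
  ultimately show ?thesis unfolding SQ_def using assms(4) hyp by blast
qed

text \<open>The fixed points solve a quadratic equation in coordinates with respect to
  \<open>u\<close>, \<open>v\<close>. Orthogonality makes its roots opposite, so the middle
  coefficient \<open>c - d\<close> vanishes and \<open>a\<close>, \<open>b\<close> have the same
  sign; that of \<open>c\<close> comes from the image of the crossing point.\<close>

lemma SQ_geodE:
  assumes "p \<noteq> q" "lift p u" "lift q v" "A \<in> SQ (geod p q) {z \<in> H2. Qf u v z < 0}"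
  obtains a b c where "A \<in> SL2" "A *v u = c *\<^sub>R u + a *\<^sub>R v" "A *v v = b *\<^sub>R u + c *\<^sub>R v"
    "c * a > 0" "c * b > 0"
proof -
  have nz: "wd u v \<noteq> 0" using assms wd_lift by blast
  obtain Ax where A: "A \<in> SL2" "hyperbolic A" "trans_axis A Ax" "orthogonal_geods Ax (geod p q)"
    "\<forall>z \<in> Ax \<inter> geod p q. mob A z \<in> {z \<in> H2. Qf u v z < 0}"
    using assms(4) unfolding SQ_def by blast
  obtain \<xi> \<eta> where ax: "\<xi> \<noteq> \<eta>" "bd_act A \<xi> = \<xi>" "bd_act A \<eta> = \<eta>" "Ax = geod \<xi> \<eta>"
    using A(3) unfolding trans_axis_def by blast
  define x where "x = bd_vec \<xi>"
  define y where "y = bd_vec \<eta>"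
  have le: "lift \<xi> x" "lift \<eta> y" by (simp_all add: x_def y_def)
  have fp: "wd (A *v x) x = 0" "wd (A *v y) y = 0"
    using bd_act_fixed_iff[OF A(1)] le ax by blast+
  have o: "geod \<xi> \<eta> \<inter> geod p q \<noteq> {}" "wd x u * wd y v + wd x v * wd y u = 0"
    using orthogonal_geods_iff[OF assms(1) ax(1) assms(2,3) le] A(4) ax(4) by blast+
  obtain c a where Au: "A *v u = c *\<^sub>R u + a *\<^sub>R v" using wd_basis[OF nz] .
  obtain b d where Av: "A *v v = b *\<^sub>R u + d *\<^sub>R v" using wd_basis[OF nz] .
  obtain x1 x2 where x: "x = x1 *\<^sub>R u + x2 *\<^sub>R v" using wd_basis[OF nz] .
  obtain y1 y2 where y: "y = y1 *\<^sub>R u + y2 *\<^sub>R v" using wd_basis[OF nz] .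
  have Ac: "A *v (s *\<^sub>R u + t *\<^sub>R v) = (c * s + b * t) *\<^sub>R u + (a * s + d * t) *\<^sub>R v" for s t
    by (simp add: matrix_vector_right_distrib matrix_vector_mult_scaleR Au Av algebra_simps)
  have fx: "wd (A *v (s *\<^sub>R u + t *\<^sub>R v)) (s *\<^sub>R u + t *\<^sub>R v)
      = (b * (t * t) + (c - d) * (s * t) - a * (s * s)) * wd u v" for s t
    unfolding Ac by (simp add: wd_swap[of v u] algebra_simps)
  have ex: "b * (x2 * x2) + (c - d) * (x1 * x2) - a * (x1 * x1) = 0"
    and ey: "b * (y2 * y2) + (c - d) * (y1 * y2) - a * (y1 * y1) = 0"
    using fp nz unfolding x y fx by simp_all
  have "wd x y = (x1 * y2 - x2 * y1) * wd u v"
    by (simp add: x y wd_swap[of v u] algebra_simps)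
  then have ind: "x1 * y2 - x2 * y1 \<noteq> 0" using wd_lift[OF le] ax(1) by auto
  have "wd x u * wd y v + wd x v * wd y u = - (x1 * y2 + x2 * y1) * (wd u v)\<^sup>2"
    by (simp add: x y wd_swap[of v u] power2_eq_square algebra_simps)
  then have har: "x1 * y2 = - (x2 * y1)" using o(2) nz by simp
  have x12: "x1 \<noteq> 0" "x2 \<noteq> 0" "y2 \<noteq> 0" using har ind by auto
  have "(c - d) * (x2 * y2) * (x1 * y2 - x2 * y1) = 0"
    using ex ey har by algebra
  then have cd: "d = c" using x12 ind by simp
  have bx: "b * (x2 * x2) = a * (x1 * x1)" using ex cd by simp
  have det: "c * c - a * b = 1" using SL2_inv_on_basis(1)[OF A(1) nz Au Av] cd by simp
  have a0: "a \<noteq> 0"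
  proof
    assume "a = 0"
    then have "b = 0" using bx x12 by simp
    then have "A *v u = c *\<^sub>R u" "A *v v = c *\<^sub>R v" using Au Av cd \<open>a = 0\<close> by simp_all
    then have "is_id A" by (rule is_id_scalar[OF A(1) nz])
    then show False using A(2) by (simp add: hyperbolic_def)
  qed
  have "a * b * (x2 * x2) = a * a * (x1 * x1)" using bx by (simp add: algebra_simps)
  also have "\<dots> > 0" using a0 x12 by (auto simp: zero_less_mult_iff linorder_neq_iff)
  finally have ab: "a * b > 0" using x12 by (auto simp: zero_less_mult_iff)
  obtain z where "z \<in> geod \<xi> \<eta> \<inter> geod p q" using o(1) by blast
  then have z: "z \<in> H2" "Qf u v z = 0" "Qf u v (mob A z) < 0"
    using A(5) ax(4) by (auto simp: geod_Qf[OF assms(2,3)])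
  have "u \<noteq> 0" "v \<noteq> 0" using nz by auto
  then have Qp: "Qf u u z > 0" "Qf v v z > 0" using Qf_self_pos[OF z(1)] by blast+
  have "jac A z * Qf u v (mob A z) < 0"
    using z(3) mob_Re_Im(1)[OF A(1) z(1)] by (simp add: mult_less_0_iff)
  then have pos: "c * b * Qf u u z + c * a * Qf v v z > 0"
    using Qf_mob_orthogonal[OF A(1) nz Au Av[unfolded cd] z(1,2)] by linarith
  have "(c * a) * (c * b) > 0"
  proof -
    have "c \<noteq> 0" using det ab by auto
    then have "c * c * (a * b) > 0" using ab by (auto simp: zero_less_mult_iff linorder_neq_iff)
    then show ?thesis by (simp add: algebra_simps)
  qed
  then consider "c * a > 0" "c * b > 0" | "c * a < 0" "c * b < 0"
    by (auto simp: zero_less_mult_iff)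
  then show ?thesis
  proof cases
    case 1
    show ?thesis by (rule that[OF A(1) Au Av[unfolded cd] 1])
  next
    case 2
    then have "c * b * Qf u u z < 0" "c * a * Qf v v z < 0" using Qp by (simp_all add: mult_neg_pos)
    then show ?thesis using pos by simp
  qed
qed

subsection \<open>Elements with a nonattracting fixed point\<close>

lemma wd_partner_exists:
  assumes "v \<noteq> 0"
  obtains u where "wd v u = 1"
proof -
  have "\<exists>u. wd v u \<noteq> 0"
  proof (rule ccontr)
    assume "\<nexists>u. wd v u \<noteq> 0"
    then have "wd v (\<chi> i. if i = 1 then 0 else 1) = 0" "wd v (\<chi> i. if i = 1 then 1 else 0) = 0" by blast+
    then show False using assms by (simp add: wd_def vec_eq_iff forall_2)
  qed
  then obtain u where "wd v u \<noteq> 0" by blast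
  then have "wd v ((1 / wd v u) *\<^sub>R u) = 1" by simp
  then show ?thesis by (rule that)
qed

text \<open>In the basis \<open>v\<close>, \<open>u\<close> the matrix is triangular with diagonal
  entries \<open>k\<close> and \<open>1 / k\<close>, which differ.\<close>

lemma second_eigenvector:
  assumes "A \<in> SL2" "v \<noteq> 0" "A *v v = k *\<^sub>R v" "\<bar>k\<bar> \<noteq> 1"
  obtains w where "wd v w \<noteq> 0" "A *v w = (1 / k) *\<^sub>R w"
proof -
  obtain u where u: "wd v u = 1" using wd_partner_exists[OF assms(2)] .
  then have nz: "wd v u \<noteq> 0" by simp
  obtain x l where Au: "A *v u = x *\<^sub>R v + l *\<^sub>R u" using wd_basis[OF nz] .
  have kl: "k * l = 1"
    using SL2_inv_on_basis(1)[OF assms(1) nz _ Au, of k 0] assms(3) by simp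
  then have k0: "k \<noteq> 0" by auto
  then have k: "l = 1 / k" using kl by (simp add: eq_divide_eq mult.commute)
  have "l \<noteq> k"
  proof
    assume "l = k"
    then have "k\<^sup>2 = 1" using kl by (simp add: power2_eq_square)
    then show False using assms(4) by (simp add: abs_square_eq_1)
  qed
  \<comment> \<open>Solves \<open>k * y + x = l * y\<close>, which makes
    \<open>y *\<^sub>R v + u\<close> an eigenvector for \<open>l\<close>.\<close>
  define y where "y = x / (l - k)"
  have y: "k * y + x = l * y" using \<open>l \<noteq> k\<close> by (simp add: y_def field_simps)
  have "A *v (y *\<^sub>R v + u) = (k * y + x) *\<^sub>R v + l *\<^sub>R u"
    by (simp add: matrix_vector_right_distrib matrix_vector_mult_scaleR assms(3) Au algebra_simps)
  also have "\<dots> = (1 / k) *\<^sub>R (y *\<^sub>R v + u)"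
    unfolding y by (simp add: scaleR_add_right k)
  finally show ?thesis using that[of "y *\<^sub>R v + u"] u by simp
qed

lemma hyperbolicI:
  assumes "A \<in> SL2" "v \<noteq> 0" "A *v v = k *\<^sub>R v" "\<bar>k\<bar> \<noteq> 1"
  shows "hyperbolic A"
proof -
  obtain w where w: "wd v w \<noteq> 0" "A *v w = (1 / k) *\<^sub>R w"
    using second_eigenvector[OF assms] .
  then have "w \<noteq> 0" by auto
  obtain \<xi> \<eta> where le: "lift \<xi> v" "lift \<eta> w"
    using lift_exists assms(2) \<open>w \<noteq> 0\<close> by metis
  have "bd_act A \<xi> = \<xi>" "bd_act A \<eta> = \<eta>"
    using bd_act_fixed_iff[OF assms(1)] le assms(3) w(2) by simp_all
  moreover have "\<xi> \<noteq> \<eta>" using wd_lift[OF le] w(1) by blast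
  moreover have "\<not> is_id A"
  proof
    assume "is_id A"
    then have "A *v v = v \<or> A *v v = - v"
      unfolding is_id_def by (auto simp: vec_eq_iff forall_2 mult_vec_2 mat_def)
    then have "(k - 1) *\<^sub>R v = 0 \<or> (k + 1) *\<^sub>R v = 0"
      using assms(3) by (auto simp: algebra_simps)
    then show False using assms(2,4) by auto
  qed
  ultimately show ?thesis unfolding hyperbolic_def by blast
qed

text \<open>An eigenvalue of any other modulus comes with a second boundary fixed point.\<close>

lemma parabolic_eigenvalue:
  assumes "A \<in> SL2" "parabolic A" "v \<noteq> 0" "A *v v = k *\<^sub>R v"
  shows "\<bar>k\<bar> = 1"
proof (rule ccontr)
  assume "\<bar>k\<bar> \<noteq> 1"
  then have "hyperbolic A" using hyperbolicI assms by blast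
  then show False using assms(2) unfolding hyperbolic_def parabolic_def by blast
qed

text \<open>In the basis \<open>v\<close>, \<open>u\<close> the matrix is triangular with both
  diagonal entries \<open>k\<close> and a nonzero corner \<open>x\<close>. A second boundary fixed
  point, or a fixed point in \<open>H2\<close>, would force \<open>x = 0\<close>.\<close>

lemma unipotent_id_or_parabolic:
  assumes "A \<in> SL2" "v \<noteq> 0" "A *v v = k *\<^sub>R v" "\<bar>k\<bar> = 1" "\<not> is_id A"
  shows "parabolic A"
proof -
  obtain u where u: "wd v u = 1" using wd_partner_exists[OF assms(2)] .
  then have nz: "wd v u \<noteq> 0" by simp
  obtain x l where Au: "A *v u = x *\<^sub>R v + l *\<^sub>R u" using wd_basis[OF nz] .
  have kk: "k * k = 1" using assms(4) by (auto simp: abs_if split: if_splits)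
  have "k * l = 1"
    using SL2_inv_on_basis(1)[OF assms(1) nz _ Au, of k 0] assms(3) by simp
  then have "(k * k) * l = k" by (simp add: mult.assoc)
  then have l: "l = k" unfolding kk by simp
  have x: "x \<noteq> 0"
  proof
    assume "x = 0"
    then have "A *v u = k *\<^sub>R u" using Au l by simp
    then show False using is_id_scalar[OF assms(1) nz assms(3)] assms(5) by blast
  qed
  obtain \<xi> where \<xi>: "lift \<xi> v" using lift_exists assms(2) by blast
  have "\<eta> = \<xi>" if "bd_act A \<eta> = \<eta>" for \<eta>
  proof -
    obtain b c where w: "bd_vec \<eta> = b *\<^sub>R v + c *\<^sub>R u" using wd_basis[OF nz] .
    have "wd (A *v bd_vec \<eta>) (bd_vec \<eta>) = 0"
      using that bd_act_fixed_iff[OF assms(1) lift_bd_vec] by blast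
    then have "x * (c * c) = 0" unfolding w
      by (simp add: matrix_vector_right_distrib matrix_vector_mult_scaleR assms(3) Au l wd_swap[of u v] u algebra_simps)
    then have "c = 0" using x by simp
    then have "wd (bd_vec \<eta>) v = 0" by (simp add: w)
    then show ?thesis using wd_lift[OF lift_bd_vec \<xi>] by blast
  qed
  moreover have "bd_act A \<xi> = \<xi>" using bd_act_fixed_iff[OF assms(1) \<xi>] assms(3) by simp
  moreover have "mob A z \<noteq> z" if "z \<in> H2" for z
  proof
    assume z: "mob A z = z"
    have vv: "Qf v v z > 0" using Qf_self_pos[OF that assms(2)] .
    have "jac A z * Qf (A *v v) (A *v v) z = Qf v v z" "jac A z * Qf (A *v u) (A *v v) z = Qf u v z"
      using Qf_mob[OF assms(1) that] z by simp_all
    moreover have "jac A z = 1"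
      using mob_Re_Im(2)[OF assms(1) that] that z by (simp add: H2_def)
    ultimately have "Qf (x *\<^sub>R v + k *\<^sub>R u) (k *\<^sub>R v) z = Qf u v z"
      by (simp add: assms(3) Au l)
    then have "k * x * Qf v v z + (k * k) * Qf u v z = Qf u v z" by (simp add: algebra_simps)
    then have "k * x * Qf v v z = 0" unfolding kk by simp
    then show False using x vv assms(4) by auto
  qed
  ultimately show ?thesis unfolding parabolic_def using assms(5) by blast
qed

text \<open>The modulus of the eigenvalue selects the type: below 1 the endpoint is repelling, and
  equal to 1 the element is trivial or parabolic.\<close>

lemma Cstar_idealI:
  assumes "p \<noteq> q" "\<xi> \<in> {p, q}" "lift \<xi> v" "A \<in> SL2" "A *v v = k *\<^sub>R v" "\<bar>k\<bar> \<le> 1"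
  shows "A \<in> Cstar (geod p q)"
proof -
  have v: "v \<noteq> 0" using lift_nonzero assms(3) by blast
  have e: "\<xi> \<in> ends (geod p q)" using assms(1,2) by (simp add: ends_geod)
  have f: "bd_act A \<xi> = \<xi>" using bd_act_fixed_iff[OF assms(4,3)] assms(5) by simp
  consider "is_id A" | "\<bar>k\<bar> < 1" | "\<bar>k\<bar> = 1" "\<not> is_id A" using assms(6) by linarith
  then show ?thesis
  proof cases
    case 2
    then have "hyperbolic A" using hyperbolicI[OF assms(4) v assms(5)] by simp
    moreover have "A *v bd_vec \<xi> = k *\<^sub>R bd_vec \<xi>"
    proof -
      obtain c where "c \<noteq> 0" "v = c *\<^sub>R bd_vec \<xi>" using assms(3) unfolding lift_def by blast
      moreover from this have "c *\<^sub>R (A *v bd_vec \<xi>) = c *\<^sub>R (k *\<^sub>R bd_vec \<xi>)"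
        using assms(5) by (simp add: matrix_vector_mult_scaleR mult.commute)
      ultimately show ?thesis by (metis scaleR_left_imp_eq)
    qed
    ultimately have "repelling_fp A \<xi>" unfolding repelling_fp_def using f 2 by blast
    then show ?thesis unfolding Cstar_def using assms(4) e \<open>hyperbolic A\<close> by blast
  next
    case 3
    then have "parabolic A" using unipotent_id_or_parabolic[OF assms(4) v assms(5)] by blast
    then show ?thesis unfolding Cstar_def using assms(4) e f by blast
  qed (use assms(4) in \<open>simp add: Cstar_def\<close>)
qed

text \<open>In the standard basis the form has coefficients \<open>1\<close>, \<open>- Re z\<close>
  and the squared modulus of \<open>z\<close>; the first one forces \<open>j = 1\<close>.\<close>

lemma Qf_determines_point:
  assumes "z \<in> H2" "w \<in> H2" "\<And>a b. j * Qf a b w = Qf a b z"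
  shows "w = z"
proof -
  let ?a = "bd_vec None" let ?b = "bd_vec (Some 0)"
  have j: "j = 1" using assms(3)[of ?a ?a] by (simp add: Qf_def)
  have re: "Re w = Re z" using assms(3)[of ?a ?b] j by (simp add: Qf_def)
  have "(Im w)\<^sup>2 = (Im z)\<^sup>2" using assms(3)[of ?b ?b] j re by (simp add: Qf_def)
  then have "Im w = Im z" using assms(1,2) by (simp add: H2_def)
  with re show ?thesis by (simp add: complex_eq_iff)
qed

text \<open>\<open>A\<close> preserves the form with weights \<open>r\<close> and 1, so it is
  trivial or a rotation about the corresponding point of the geodesic.\<close>

lemma Cstar_interiorI:
  assumes "p \<noteq> q" "lift p u" "lift q v" "A \<in> SL2" "r > 0"
    and "A *v u = a *\<^sub>R u + b *\<^sub>R v" "A *v v = - (r * b) *\<^sub>R u + a *\<^sub>R v"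
  shows "A \<in> Cstar (geod p q)"
proof -
  have nz: "wd u v \<noteq> 0" using assms wd_lift by blast
  have det: "a * a + r * b * b = 1" using SL2_inv_on_basis(1)[OF assms(4) nz assms(6,7)] by (simp add: algebra_simps)
  obtain z k where z: "z \<in> H2" "k > 0"
    "\<And>c d. k * Qf c d z = r * (wd c u * wd d u) + 1 * (wd c v * wd d v)"
    using geod_point_exists[OF nz assms(5) zero_less_one] by blast
  have "k * Qf u v z = 0" unfolding z(3) by simp
  then have zg: "z \<in> geod p q" using z(1,2) by (simp add: geod_Qf[OF assms(2,3)])
  have "jac A z * Qf c d (mob A z) = Qf c d z" for c d
  proof -
    have "k * (jac A z * Qf c d (mob A z)) = r * (wd c (A *v u) * wd d (A *v u)) + wd c (A *v v) * wd d (A *v v)"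
      unfolding Qf_mob_inv[OF assms(4) z(1)] z(3) wd_matrix_inv[OF assms(4)] by simp
    also have "\<dots> = (a * a + r * b * b) * (r * (wd c u * wd d u) + wd c v * wd d v)"
      unfolding assms(6,7) by (simp add: algebra_simps)
    also have "\<dots> = k * Qf c d z" unfolding det z(3) by simp
    finally show ?thesis using z(2) by simp
  qed
  then have "mob A z = z"
    using Qf_determines_point[OF z(1) mob_H2[OF assms(4) z(1)]] by blast
  then show ?thesis unfolding Cstar_def elliptic_def using assms(4) z(1) zg by blast
qed

text \<open>The form is that of the fixed point. For a point of \<open>H2\<close> it is invariant,
  so \<open>k = 1\<close>. For an endpoint it is the square of one linear form and \<open>k\<close>
  is the squared eigenvalue, at most 1 as the endpoint is not attracting. For the identity any form
  will do.\<close>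

lemma Cstar_form:
  assumes "A \<in> Cstar (geod p q)" "p \<noteq> q" "lift p u" "lift q v"
  obtains s t k where "A \<in> SL2" "s \<ge> 0" "t \<ge> 0" "s + t > 0" "0 < k" "k \<le> 1"
    "\<And>a b. k * (s * (wd a u * wd b u) + t * (wd a v * wd b v)) =
      s * (wd a (A *v u) * wd b (A *v u)) + t * (wd a (A *v v) * wd b (A *v v))"
proof -
  have nz: "wd u v \<noteq> 0" using assms wd_lift by blast
  have A: "A \<in> SL2" using assms(1) unfolding Cstar_def by blast
  note form = that
  have ideal: thesis if \<xi>: "\<xi> \<in> ends (geod p q)" "lift \<xi> w" "A *v w = k *\<^sub>R w" "\<bar>k\<bar> \<le> 1" for \<xi> w k
  proof -
    have "w \<noteq> 0" using lift_nonzero \<xi>(2) by blast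
    have "bd_act A \<xi> = \<xi>" using bd_act_fixed_iff[OF A \<xi>(2)] \<xi>(3) by simp
    then obtain k' where "A *v w = k' *\<^sub>R w" "k' \<noteq> 0" using bd_act_fixed_eigen[OF A \<xi>(2)] by blast
    then have k0: "k \<noteq> 0" using \<xi>(3) \<open>w \<noteq> 0\<close> by auto
    have k2: "0 < k * k" "k * k \<le> 1"
      using k0 \<xi>(4) abs_square_le_1[of k] by (simp_all add: power2_eq_square zero_less_mult_iff linorder_neq_iff disj_commute)
    have *: "A *v x = k *\<^sub>R x" if "lift \<xi> x" for x
    proof -
      have "wd w x = 0" using wd_lift[OF \<xi>(2) that] by blast
      then obtain c where "x = c *\<^sub>R w" using wd_zero_imp_parallel \<open>w \<noteq> 0\<close> by blast
      then show ?thesis using \<xi>(3) by (simp add: matrix_vector_mult_scaleR)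
    qed
    have "\<xi> = p \<or> \<xi> = q" using \<xi>(1) ends_geod[OF assms(2)] by simp
    then have "A *v u = k *\<^sub>R u \<or> A *v v = k *\<^sub>R v"
      using *[of u] *[of v] assms(3,4) by metis
    then show ?thesis
    proof
      assume "A *v u = k *\<^sub>R u"
      then show ?thesis using form[of 1 0 "k * k"] A k2 by (simp add: algebra_simps)
    next
      assume "A *v v = k *\<^sub>R v"
      then show ?thesis using form[of 0 1 "k * k"] A k2 by (simp add: algebra_simps)
    qed
  qed
  consider "is_id A" | z where "z \<in> geod p q" "mob A z = z"
    | \<xi> where "parabolic A" "\<xi> \<in> ends (geod p q)" "bd_act A \<xi> = \<xi>"
    | \<xi> where "\<xi> \<in> ends (geod p q)" "repelling_fp A \<xi>"
    using assms(1) unfolding Cstar_def by blast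
  then show ?thesis
  proof cases
    case 1
    then have "\<And>x. A *v x = x \<or> A *v x = - x"
      unfolding is_id_def by (auto simp: vec_eq_iff forall_2 mult_vec_2 mat_def)
    then have "wd a (A *v u) * wd b (A *v u) = wd a u * wd b u" for a b
      by (metis minus_mult_minus wd_minus(2))
    then show ?thesis using form[of 1 0 1] A by simp
  next
    case 2
    then have z: "z \<in> H2" "Qf u v z = 0" by (simp_all add: geod_Qf[OF assms(3,4)])
    obtain s t where st: "s > 0" "t > 0"
      "\<And>a b. Qf a b z = s * (wd a u * wd b u) + t * (wd a v * wd b v)"
      using geod_point_decomp[OF nz z] by blast
    have "jac A z = 1"
      using mob_Re_Im(2)[OF A z(1)] z(1) 2(2) by (simp add: H2_def)
    then have "Qf a b z = Qf (matrix_inv A *v a) (matrix_inv A *v b) z" for a b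
      using Qf_mob_inv[OF A z(1), of a b] 2(2) by simp
    then have "s * (wd a u * wd b u) + t * (wd a v * wd b v) =
      s * (wd a (A *v u) * wd b (A *v u)) + t * (wd a (A *v v) * wd b (A *v v))" for a b
      unfolding st(3) wd_matrix_inv[OF A] .
    then show ?thesis using form[of s t 1] A st(1,2) by simp
  next
    case 3
    obtain k where k: "A *v bd_vec \<xi> = k *\<^sub>R bd_vec \<xi>"
      using bd_act_fixed_eigen[OF A lift_bd_vec 3(3)] by blast
    then have "\<bar>k\<bar> = 1" using parabolic_eigenvalue[OF A 3(1) _ k] lift_nonzero[OF lift_bd_vec] by blast
    then show ?thesis using ideal[OF 3(2) lift_bd_vec k] by simp
  next
    case 4
    then obtain k where k: "\<bar>k\<bar> < 1" "A *v bd_vec \<xi> = k *\<^sub>R bd_vec \<xi>" unfolding repelling_fp_def by blast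
    then show ?thesis using ideal[OF 4(1) lift_bd_vec k(2)] by simp
  qed
qed

subsection \<open>Frames of disjoint geodesics\<close>

text \<open>In the matrix with rows \<open>a, b\<close> and \<open>c, d\<close> no row or column
  mixes signs, and a column with two nonzero entries ties the rows together.\<close>

lemma same_sign_2x2:
  fixes a b c d :: real
  assumes "a * c \<ge> 0" "b * d \<ge> 0" "a * c + b * d > 0" "a * b \<ge> 0" "c * d \<ge> 0"
  shows "(a \<ge> 0 \<and> b \<ge> 0 \<and> c \<ge> 0 \<and> d \<ge> 0) \<or> (a \<le> 0 \<and> b \<le> 0 \<and> c \<le> 0 \<and> d \<le> 0)"
proof -
  have "a * c > 0 \<or> b * d > 0" using assms by linarith
  then show ?thesis using assms by (auto simp: zero_le_mult_iff zero_less_mult_iff)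
qed

text \<open>Along the second geodesic the form of the first is, up to positive factors,
  \<open>s * ?X + t * ?Y\<close> with arbitrary positive weights. It never vanishes, so
  \<open>?X\<close> and \<open>?Y\<close> are neither of opposite sign nor both 0; \<open>e\<close>
  is their common sign.\<close>

lemma disjoint_geods_sign:
  assumes "geod p q \<inter> geod p' q' = {}" "p' \<noteq> q'" "lift p u" "lift q v" "lift p' x" "lift q' y"
  obtains e where "e = 1 \<or> e = (-1::real)" "e * (wd u x * wd v x) \<ge> 0" "e * (wd u y * wd v y) \<ge> 0"
    "e * (wd u x * wd v x) + e * (wd u y * wd v y) > 0"
proof -
  let ?X = "wd u x * wd v x" and ?Y = "wd u y * wd v y"
  have nz: "wd x y \<noteq> 0" using assms wd_lift by blast
  have ne: "s * ?X + t * ?Y \<noteq> 0" if st: "s > 0" "t > 0" for s t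
  proof -
    obtain z k where z: "z \<in> H2" "k > 0"
      "\<And>a b. k * Qf a b z = s * (wd a x * wd b x) + t * (wd a y * wd b y)"
      using geod_point_exists[OF nz st] by blast
    have "k * Qf x y z = 0" unfolding z(3) by simp
    then have "z \<in> geod p' q'" using z(1,2) by (simp add: geod_Qf[OF assms(5,6)])
    then have "z \<notin> geod p q" using assms(1) by blast
    then have "k * Qf u v z \<noteq> 0" using z(1,2) by (simp add: geod_Qf[OF assms(3,4)])
    then show ?thesis unfolding z(3) .
  qed
  have "?X * ?Y \<ge> 0"
  proof (rule ccontr)
    assume "\<not> ?X * ?Y \<ge> 0"
    then have lt: "?X < 0 \<and> ?Y > 0 \<or> ?X > 0 \<and> ?Y < 0" by (metis linorder_not_le mult_less_0_iff)
    then have "\<bar>?Y\<bar> * ?X + \<bar>?X\<bar> * ?Y = 0" "\<bar>?Y\<bar> > 0" "\<bar>?X\<bar> > 0"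
      by (auto simp: algebra_simps)
    then show False using ne by blast
  qed
  then have "?X \<ge> 0 \<and> ?Y \<ge> 0 \<or> ?X \<le> 0 \<and> ?Y \<le> 0" by (simp add: zero_le_mult_iff)
  moreover have "?X + ?Y \<noteq> 0" using ne[of 1 1] by simp
  ultimately show ?thesis using that[of 1] that[of "-1"] by fastforce
qed

text \<open>First \<open>v\<close> gets the sign that puts the second geodesic on the positive side
  of the first, then \<open>y\<close> the sign for the reverse; this keeps the former, where
  \<open>y\<close> enters quadratically. All four pairings then agree in sign, and negating
  \<open>u\<close> and \<open>v\<close> together makes them nonnegative if necessary.\<close>

lemma disjoint_geods_frames:
  assumes "geod p q \<inter> geod p' q' = {}" "p \<noteq> q" "p' \<noteq> q'"
  obtains u v x y where "lift p u" "lift q v" "lift p' x" "lift q' y"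
    "wd u x \<ge> 0" "wd u y \<ge> 0" "wd v x \<ge> 0" "wd v y \<ge> 0"
    "wd u x * wd v x + wd u y * wd v y > 0" "wd u x * wd u y + wd v x * wd v y > 0"
proof -
  define u where "u = bd_vec p"
  define x where "x = bd_vec p'"
  have l: "lift p u" "lift p' x" by (simp_all add: u_def x_def)
  obtain e where e: "e = 1 \<or> e = (-1::real)" "e * (wd u x * wd (bd_vec q) x) \<ge> 0"
    "e * (wd u (bd_vec q') * wd (bd_vec q) (bd_vec q')) \<ge> 0"
    "e * (wd u x * wd (bd_vec q) x) + e * (wd u (bd_vec q') * wd (bd_vec q) (bd_vec q')) > 0"
    using disjoint_geods_sign[OF assms(1,3) l(1) lift_bd_vec l(2) lift_bd_vec] by blast
  define v where "v = e *\<^sub>R bd_vec q"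
  have lv: "lift q v" using e(1) by (auto simp: v_def lift_uminus)
  have dis: "geod p' q' \<inter> geod p q = {}" using assms(1) by blast
  obtain f where f: "f = 1 \<or> f = (-1::real)" "f * (wd x u * wd (bd_vec q') u) \<ge> 0"
    "f * (wd x v * wd (bd_vec q') v) \<ge> 0"
    "f * (wd x u * wd (bd_vec q') u) + f * (wd x v * wd (bd_vec q') v) > 0"
    using disjoint_geods_sign[OF dis assms(2) l(2) lift_bd_vec l(1) lv] by blast
  define y where "y = f *\<^sub>R bd_vec q'"
  have ly: "lift q' y" using f(1) by (auto simp: y_def lift_uminus)
  have ff: "f * f = 1" using f(1) by auto
  have 1: "wd u x * wd v x \<ge> 0" "wd u y * wd v y \<ge> 0" "wd u x * wd v x + wd u y * wd v y > 0"
  proof -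
    have "wd u x * wd v x = e * (wd u x * wd (bd_vec q) x)" by (simp add: v_def algebra_simps)
    moreover have "wd u y * wd v y = (f * f) * (e * (wd u (bd_vec q') * wd (bd_vec q) (bd_vec q')))"
      by (simp add: v_def y_def algebra_simps)
    ultimately show "wd u x * wd v x \<ge> 0" "wd u y * wd v y \<ge> 0" "wd u x * wd v x + wd u y * wd v y > 0"
      using e(2-4) unfolding ff mult_1 by linarith+
  qed
  have 2: "wd u x * wd u y \<ge> 0" "wd v x * wd v y \<ge> 0" "wd u x * wd u y + wd v x * wd v y > 0"
  proof -
    have "wd u x * wd u y = f * (wd x u * wd (bd_vec q') u)" "wd v x * wd v y = f * (wd x v * wd (bd_vec q') v)"
      by (simp_all add: y_def wd_swap[of x] wd_swap[of "bd_vec q'"])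
    then show "wd u x * wd u y \<ge> 0" "wd v x * wd v y \<ge> 0" "wd u x * wd u y + wd v x * wd v y > 0"
      using f by simp_all
  qed
  from same_sign_2x2[OF 1(1,2,3) 2(1,2)] show ?thesis
  proof
    assume "wd u x \<ge> 0 \<and> wd u y \<ge> 0 \<and> wd v x \<ge> 0 \<and> wd v y \<ge> 0"
    then show ?thesis using that[OF l(1) lv l(2) ly] 1 2 by blast
  next
    assume "wd u x \<le> 0 \<and> wd u y \<le> 0 \<and> wd v x \<le> 0 \<and> wd v y \<le> 0"
    then show ?thesis
      using that[OF lift_uminus[OF l(1)] lift_uminus[OF lv] l(2) ly] 1 2 by simp
  qed
qed

text \<open>On the second geodesic \<open>Qf u v\<close> is a positive combination of the two
  products, hence positive; the side pointing away is the negative one.\<close>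

lemma away_frames:
  assumes "p \<noteq> q" "p' \<noteq> q'" "lift p u" "lift q v" "lift p' x" "lift q' y"
    "wd u x * wd v x \<ge> 0" "wd u y * wd v y \<ge> 0" "wd u x * wd v x + wd u y * wd v y > 0"
  shows "away (geod p q) (geod p' q') = {z \<in> H2. Qf u v z < 0}"
proof (rule away_geod[OF assms(3,4) geod_nonempty[OF assms(2)]])
  have nz: "wd x y \<noteq> 0" using assms wd_lift by blast
  show "geod p' q' \<subseteq> {z \<in> H2. Qf u v z > 0}"
  proof
    fix z assume "z \<in> geod p' q'"
    then have z: "z \<in> H2" "Qf x y z = 0" by (simp_all add: geod_Qf[OF assms(5,6)])
    obtain s t where st: "s > 0" "t > 0" "\<And>a b. Qf a b z = s * (wd a x * wd b x) + t * (wd a y * wd b y)"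
      using geod_point_decomp[OF nz z] by blast
    have "wd u x * wd v x > 0 \<or> wd u y * wd v y > 0" using assms(7-9) by linarith
    then have "Qf u v z > 0" unfolding st(3)
    proof
      assume "wd u x * wd v x > 0"
      then show "s * (wd u x * wd v x) + t * (wd u y * wd v y) > 0"
        using st(1,2) assms(8) by (intro add_pos_nonneg mult_pos_pos[of s] mult_nonneg_nonneg[of t]) auto
    next
      assume "wd u y * wd v y > 0"
      then show "s * (wd u x * wd v x) + t * (wd u y * wd v y) > 0"
        using st(1,2) assms(7) by (intro add_nonneg_pos mult_pos_pos[of t] mult_nonneg_nonneg[of s]) auto
    qed
    then show "z \<in> {z \<in> H2. Qf u v z > 0}" using z by simp
  qed
qed

subsection \<open>From the stem quadrants to disjointness\<close>

text \<open>With constant signs nothing cancels, so absolute values may be taken. The first term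
  exceeds \<open>|n1|\<close> unless \<open>n1 = 0\<close>, and then another term is
  nonzero.\<close>

lemma dominated_by_combination:
  fixes p1 p2 p3 p4 n1 n2 n3 n4 :: real
  assumes "(p1 > 0 \<and> p2 > 0 \<and> p3 > 0 \<and> p4 > 0) \<or> (p1 < 0 \<and> p2 < 0 \<and> p3 < 0 \<and> p4 < 0)" "\<bar>p1\<bar> > 1"
    and "(n1 \<ge> 0 \<and> n2 \<ge> 0 \<and> n3 \<ge> 0 \<and> n4 \<ge> 0) \<or> (n1 \<le> 0 \<and> n2 \<le> 0 \<and> n3 \<le> 0 \<and> n4 \<le> 0)"
    and "n1 \<noteq> 0 \<or> n2 \<noteq> 0 \<or> n3 \<noteq> 0 \<or> n4 \<noteq> 0"
  shows "n1\<^sup>2 < (p1 * n1 + p2 * n2 + p3 * n3 + p4 * n4)\<^sup>2"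
proof -
  have pos: "n1 < p1 * n1 + p2 * n2 + p3 * n3 + p4 * n4"
    if "p1 > 1" "p2 > 0" "p3 > 0" "p4 > 0" "n1 \<ge> 0" "n2 \<ge> 0" "n3 \<ge> 0" "n4 \<ge> 0"
      "n1 \<noteq> 0 \<or> n2 \<noteq> 0 \<or> n3 \<noteq> 0 \<or> n4 \<noteq> 0" for p1 p2 p3 p4 n1 n2 n3 n4 :: real
  proof -
    have nn: "(p1 - 1) * n1 \<ge> 0" "p2 * n2 \<ge> 0" "p3 * n3 \<ge> 0" "p4 * n4 \<ge> 0" using that by simp_all
    moreover have "(p1 - 1) * n1 \<noteq> 0 \<or> p2 * n2 \<noteq> 0 \<or> p3 * n3 \<noteq> 0 \<or> p4 * n4 \<noteq> 0" using that by auto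
    ultimately have "(p1 - 1) * n1 + p2 * n2 + p3 * n3 + p4 * n4 > 0" by linarith
    then show ?thesis by (simp add: algebra_simps)
  qed
  have "\<bar>n1\<bar> < \<bar>p1\<bar> * \<bar>n1\<bar> + \<bar>p2\<bar> * \<bar>n2\<bar> + \<bar>p3\<bar> * \<bar>n3\<bar> + \<bar>p4\<bar> * \<bar>n4\<bar>"
    using assms by (intro pos) auto
  also have "\<dots> = \<bar>p1 * n1 + p2 * n2 + p3 * n3 + p4 * n4\<bar>"
    using assms(1,3)
  proof (elim disjE)
    assume *: "p1 > 0 \<and> p2 > 0 \<and> p3 > 0 \<and> p4 > 0" "n1 \<ge> 0 \<and> n2 \<ge> 0 \<and> n3 \<ge> 0 \<and> n4 \<ge> 0"
    then have "p1 * n1 \<ge> 0" "p2 * n2 \<ge> 0" "p3 * n3 \<ge> 0" "p4 * n4 \<ge> 0" by simp_all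
    then show ?thesis using * by simp
  next
    assume *: "p1 > 0 \<and> p2 > 0 \<and> p3 > 0 \<and> p4 > 0" "n1 \<le> 0 \<and> n2 \<le> 0 \<and> n3 \<le> 0 \<and> n4 \<le> 0"
    then have "p1 * n1 \<le> 0" "p2 * n2 \<le> 0" "p3 * n3 \<le> 0" "p4 * n4 \<le> 0" by (simp_all add: mult_nonneg_nonpos)
    then show ?thesis using * by simp
  next
    assume *: "p1 < 0 \<and> p2 < 0 \<and> p3 < 0 \<and> p4 < 0" "n1 \<ge> 0 \<and> n2 \<ge> 0 \<and> n3 \<ge> 0 \<and> n4 \<ge> 0"
    then have "p1 * n1 \<le> 0" "p2 * n2 \<le> 0" "p3 * n3 \<le> 0" "p4 * n4 \<le> 0" by (simp_all add: mult_nonpos_nonneg)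
    then show ?thesis using * by simp
  next
    assume *: "p1 < 0 \<and> p2 < 0 \<and> p3 < 0 \<and> p4 < 0" "n1 \<le> 0 \<and> n2 \<le> 0 \<and> n3 \<le> 0 \<and> n4 \<le> 0"
    then have "p1 * n1 \<ge> 0" "p2 * n2 \<ge> 0" "p3 * n3 \<ge> 0" "p4 * n4 \<ge> 0" by (simp_all add: mult_nonpos_nonpos)
    then show ?thesis using * by simp
  qed
  finally show ?thesis by (rule power2_strict_mono)
qed

text \<open>\<open>F\<close> is the form that \<open>A\<close> rescales; \<open>?M\<close> and
  \<open>?N\<close> pair it with the form of \<open>B\<close> and with the image of that form under
  \<open>h\<close>. From \<open>A = h ** B\<close> the scaling factors give
  \<open>?M = (k * k') * ?N\<close>, so \<open>?M \<le> ?N\<close>, whereas the bounds at the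
  endpoints give \<open>?N < ?M\<close>.\<close>

lemma Cstar_disjoint:
  assumes "p \<noteq> q" "p' \<noteq> q'" "lift p u" "lift q v" "lift p' x" "lift q' y" "h \<in> SL2"
    and n: "(wd u (h *v x))\<^sup>2 < (wd u x)\<^sup>2" "(wd u (h *v y))\<^sup>2 < (wd u y)\<^sup>2"
      "(wd v (h *v x))\<^sup>2 < (wd v x)\<^sup>2" "(wd v (h *v y))\<^sup>2 < (wd v y)\<^sup>2"
    and AB: "A \<in> Cstar (geod p q)" "B \<in> Cstar (geod p' q')" "A = h ** B"
  shows False
proof -
  obtain s t k where A: "A \<in> SL2" "s \<ge> 0" "t \<ge> 0" "s + t > 0" "0 < k" "k \<le> 1"
    "\<And>a b. k * (s * (wd a u * wd b u) + t * (wd a v * wd b v)) =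
      s * (wd a (A *v u) * wd b (A *v u)) + t * (wd a (A *v v) * wd b (A *v v))"
    using Cstar_form[OF AB(1) assms(1,3,4)] by blast
  obtain s' t' k' where B: "B \<in> SL2" "s' \<ge> 0" "t' \<ge> 0" "s' + t' > 0" "0 < k'" "k' \<le> 1"
    "\<And>a b. k' * (s' * (wd a x * wd b x) + t' * (wd a y * wd b y)) =
      s' * (wd a (B *v x) * wd b (B *v x)) + t' * (wd a (B *v y) * wd b (B *v y))"
    using Cstar_form[OF AB(2) assms(2,5,6)] by blast
  define F where "F = (\<lambda>a. s * (wd a u * wd a u) + t * (wd a v * wd a v))"
  have FA: "k * F (A *v a) = F a" for a
    unfolding F_def A(7) wd_SL2[OF A(1)] ..
  have hF: "F (h *v a) = s * (wd (matrix_inv h *v u) a)\<^sup>2 + t * (wd (matrix_inv h *v v) a)\<^sup>2" for a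
    unfolding F_def wd_matrix_inv[OF assms(7)] by (simp add: wd_swap[of _ u] wd_swap[of _ v] power2_eq_square)
  let ?N = "s' * F (h *v x) + t' * F (h *v y)" and ?M = "s' * F x + t' * F y"
  \<comment> \<open>Applied below to \<open>matrix_inv h *v u\<close> and
    \<open>matrix_inv h *v v\<close>, in terms of which \<open>F (h *v a)\<close> is a weighted sum
    of squares.\<close>
  have G: "s' * (wd a (B *v x))\<^sup>2 + t' * (wd a (B *v y))\<^sup>2 = k' * (s' * (wd a x)\<^sup>2 + t' * (wd a y)\<^sup>2)" for a
    using B(7)[of a a] by (simp add: power2_eq_square)
  have "s' * F (h *v (B *v x)) + t' * F (h *v (B *v y))
    = s * (s' * (wd (matrix_inv h *v u) (B *v x))\<^sup>2 + t' * (wd (matrix_inv h *v u) (B *v y))\<^sup>2)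
     + t * (s' * (wd (matrix_inv h *v v) (B *v x))\<^sup>2 + t' * (wd (matrix_inv h *v v) (B *v y))\<^sup>2)"
    unfolding hF by (simp add: algebra_simps)
  also have "\<dots> = k' * ?N"
    unfolding G hF by (simp add: algebra_simps)
  finally have 1: "s' * F (A *v x) + t' * F (A *v y) = k' * ?N"
    by (simp add: AB(3) matrix_vector_mul_assoc)
  have "?M = k * (s' * F (A *v x) + t' * F (A *v y))"
    by (simp add: FA[of x, symmetric] FA[of y, symmetric] algebra_simps)
  then have M: "?M = (k * k') * ?N" unfolding 1 by simp
  have N0: "?N \<ge> 0" unfolding F_def using A(2,3) B(2,3) by simp
  have "k * k' \<le> 1" using A(5,6) B(5,6) by (simp add: mult_le_one)
  then have MN: "?M \<le> ?N" unfolding M using N0 A(5) B(5) by (simp add: mult_left_le_one_le)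
  have lt: "F (h *v a) < F a" if "(wd u (h *v a))\<^sup>2 < (wd u a)\<^sup>2" "(wd v (h *v a))\<^sup>2 < (wd v a)\<^sup>2" for a
  proof -
    have F: "F a = s * (wd u a)\<^sup>2 + t * (wd v a)\<^sup>2" for a
      unfolding F_def by (simp add: wd_swap[of _ u] wd_swap[of _ v] power2_eq_square)
    have le: "s * (wd u (h *v a))\<^sup>2 \<le> s * (wd u a)\<^sup>2" "t * (wd v (h *v a))\<^sup>2 \<le> t * (wd v a)\<^sup>2"
      using that A(2,3) by (simp_all add: mult_left_mono)
    have "s > 0 \<or> t > 0" using A(2-4) by linarith
    then show ?thesis
    proof
      assume "s > 0"
      then have "s * (wd u (h *v a))\<^sup>2 < s * (wd u a)\<^sup>2" using that by simp
      then show ?thesis unfolding F using le by linarith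
    next
      assume "t > 0"
      then have "t * (wd v (h *v a))\<^sup>2 < t * (wd v a)\<^sup>2" using that by simp
      then show ?thesis unfolding F using le by linarith
    qed
  qed
  have Fx: "F (h *v x) < F x" "F (h *v y) < F y" using lt n by blast+
  have le: "s' * F (h *v x) \<le> s' * F x" "t' * F (h *v y) \<le> t' * F y"
    using Fx B(2,3) by (simp_all add: mult_left_mono)
  have "s' > 0 \<or> t' > 0" using B(2-4) by linarith
  then have "?N < ?M"
  proof
    assume "s' > 0"
    then have "s' * F (h *v x) < s' * F x" using Fx by simp
    then show ?thesis using le by linarith
  next
    assume "t' > 0"
    then have "t' * F (h *v y) < t' * F y" using Fx by simp
    then show ?thesis using le by linarith
  qed
  then show False using MN by simp
qed

text \<open>Since \<open>A = h ** B\<close> preserves \<open>wd\<close>, each pairing without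
  \<open>h\<close> is a combination of the four pairings with \<open>h\<close>. All coefficients
  share one sign, and the corresponding pairing has the coefficient \<open>c * c'\<close>, of
  modulus above 1.\<close>

lemma stem_quadrants_dominate:
  assumes "p \<noteq> q" "p' \<noteq> q'" "lift p u" "lift q v" "lift p' x" "lift q' y" "h \<in> SL2"
    and A: "A \<in> SQ (geod p q) {z \<in> H2. Qf u v z < 0}"
    and B: "B \<in> SQ (geod p' q') {z \<in> H2. Qf x y z < 0}"
    and hB: "h ** B = A"
    and n: "wd u (h *v x) * wd v (h *v x) \<ge> 0" "wd u (h *v y) * wd v (h *v y) \<ge> 0"
      "wd u (h *v x) * wd v (h *v x) + wd u (h *v y) * wd v (h *v y) > 0"
      "wd u (h *v x) * wd u (h *v y) \<ge> 0" "wd v (h *v x) * wd v (h *v y) \<ge> 0"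
  shows "(wd u (h *v x))\<^sup>2 < (wd u x)\<^sup>2 \<and> (wd u (h *v y))\<^sup>2 < (wd u y)\<^sup>2 \<and>
    (wd v (h *v x))\<^sup>2 < (wd v x)\<^sup>2 \<and> (wd v (h *v y))\<^sup>2 < (wd v y)\<^sup>2"
proof -
  obtain a b c where A: "A \<in> SL2" "A *v u = c *\<^sub>R u + a *\<^sub>R v" "A *v v = b *\<^sub>R u + c *\<^sub>R v"
    "c * a > 0" "c * b > 0" using SQ_geodE[OF assms(1,3,4) A] by blast
  obtain a' b' c' where B: "B \<in> SL2" "B *v x = c' *\<^sub>R x + a' *\<^sub>R y" "B *v y = b' *\<^sub>R x + c' *\<^sub>R y"
    "c' * a' > 0" "c' * b' > 0" using SQ_geodE[OF assms(2,5,6) B] by blast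
  have nz: "wd u v \<noteq> 0" "wd x y \<noteq> 0" using assms wd_lift by blast+
  \<comment> \<open>Determinant 1 gives \<open>c * c = 1 + a * b\<close> with
    \<open>a * b > 0\<close>.\<close>
  have gt: "\<bar>c\<bar> > 1" if "c * c - a * b = 1" "c * a > 0" "c * b > 0" for a b c :: real
  proof -
    have "a * b > 0" using that(2,3) by (auto simp: zero_less_mult_iff)
    then have "c\<^sup>2 > 1" using that(1) by (simp add: power2_eq_square)
    then show ?thesis using abs_square_le_1 by (metis linorder_not_le)
  qed
  have cc: "\<bar>c * c'\<bar> > 1"
    using gt[OF SL2_inv_on_basis(1)[OF A(1) nz(1) A(2,3)] A(4,5)]
      gt[OF SL2_inv_on_basis(1)[OF B(1) nz(2) B(2,3)] B(4,5)]
    by (simp add: abs_mult less_1_mult)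
  let ?n11 = "wd u (h *v x)" and ?n12 = "wd u (h *v y)" and ?n21 = "wd v (h *v x)" and ?n22 = "wd v (h *v y)"
  have m: "wd s r = wd (A *v s) (h *v (B *v r))" for s r
    by (simp add: wd_SL2[OF A(1)] matrix_vector_mul_assoc hB)
  note hs = matrix_vector_right_distrib matrix_vector_mult_scaleR
  have m11: "wd u x = c * c' * ?n11 + c * a' * ?n12 + a * c' * ?n21 + a * a' * ?n22"
    and m12: "wd u y = c * c' * ?n12 + c * b' * ?n11 + a * b' * ?n21 + a * c' * ?n22"
    and m21: "wd v x = c * c' * ?n21 + b * c' * ?n11 + b * a' * ?n12 + c * a' * ?n22"
    and m22: "wd v y = c * c' * ?n22 + b * b' * ?n11 + b * c' * ?n12 + c * b' * ?n21"
    unfolding m[of u x] m[of u y] m[of v x] m[of v y] A(2,3) B(2,3) by (simp_all add: hs algebra_simps)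
  have sg: "(?n11 \<ge> 0 \<and> ?n12 \<ge> 0 \<and> ?n21 \<ge> 0 \<and> ?n22 \<ge> 0) \<or> (?n11 \<le> 0 \<and> ?n12 \<le> 0 \<and> ?n21 \<le> 0 \<and> ?n22 \<le> 0)"
    by (rule same_sign_2x2[OF n])
  have n0: "?n11 \<noteq> 0 \<or> ?n12 \<noteq> 0 \<or> ?n21 \<noteq> 0 \<or> ?n22 \<noteq> 0" using n(3) by auto
  have c: "(c > 0 \<and> a > 0 \<and> b > 0) \<or> (c < 0 \<and> a < 0 \<and> b < 0)"
    "(c' > 0 \<and> a' > 0 \<and> b' > 0) \<or> (c' < 0 \<and> a' < 0 \<and> b' < 0)"
    using A(4,5) B(4,5) by (auto simp: zero_less_mult_iff)
  have co: "(c * c' > 0 \<and> c * a' > 0 \<and> c * b' > 0 \<and> a * c' > 0 \<and> a * a' > 0 \<and> a * b' > 0 \<and> b * c' > 0 \<and> b * a' > 0 \<and> b * b' > 0)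
    \<or> (c * c' < 0 \<and> c * a' < 0 \<and> c * b' < 0 \<and> a * c' < 0 \<and> a * a' < 0 \<and> a * b' < 0 \<and> b * c' < 0 \<and> b * a' < 0 \<and> b * b' < 0)"
    using c by (elim disjE) (simp_all add: mult_neg_neg mult_pos_neg mult_neg_pos)
  have "?n11\<^sup>2 < (wd u x)\<^sup>2" unfolding m11
    by (rule dominated_by_combination[OF _ cc]) (use co sg n0 in argo)+
  moreover have "?n12\<^sup>2 < (wd u y)\<^sup>2" unfolding m12
    by (rule dominated_by_combination[OF _ cc]) (use co sg n0 in argo)+
  moreover have "?n21\<^sup>2 < (wd v x)\<^sup>2" unfolding m21
    by (rule dominated_by_combination[OF _ cc]) (use co sg n0 in argo)+
  moreover have "?n22\<^sup>2 < (wd v y)\<^sup>2" unfolding m22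
    by (rule dominated_by_combination[OF _ cc]) (use co sg n0 in argo)+
  ultimately show ?thesis by blast
qed

text \<open>The image of the second geodesic under \<open>h\<close> lies on the positive side of the
  first. The pulled back form is \<open>s * ?X + t * ?Y\<close> up to a positive factor, and
  arbitrary positive weights force nonnegative coefficients.\<close>

lemma away_images_sign:
  assumes "p' \<noteq> q'" "lift p u" "lift q v" "lift p' x" "lift q' y" "h \<in> SL2"
    and "\<And>z. z \<in> geod p' q' \<Longrightarrow> mob h z \<notin> geod p q"
    and "\<And>z. z \<in> geod p' q' \<Longrightarrow> mob h z \<notin> {z \<in> H2. Qf u v z < 0}"
  shows "wd u (h *v x) * wd v (h *v x) \<ge> 0" "wd u (h *v y) * wd v (h *v y) \<ge> 0"
    "wd u (h *v x) * wd v (h *v x) + wd u (h *v y) * wd v (h *v y) > 0"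
proof -
  let ?X = "wd u (h *v x) * wd v (h *v x)" and ?Y = "wd u (h *v y) * wd v (h *v y)"
  have nz: "wd x y \<noteq> 0" using assms wd_lift by blast
  have pos: "s * ?X + t * ?Y > 0" if st: "s > 0" "t > 0" for s t
  proof -
    obtain z k where z: "z \<in> H2" "k > 0"
      "\<And>a b. k * Qf a b z = s * (wd a x * wd b x) + t * (wd a y * wd b y)"
      using geod_point_exists[OF nz st] by blast
    have "k * Qf x y z = 0" unfolding z(3) by simp
    then have "z \<in> geod p' q'" using z(1,2) by (simp add: geod_Qf[OF assms(4,5)])
    then have "mob h z \<notin> geod p q" "mob h z \<notin> {z \<in> H2. Qf u v z < 0}" using assms(7,8) by blast+
    then have "Qf u v (mob h z) > 0"
      using mob_H2[OF assms(6) z(1)] by (simp add: geod_Qf[OF assms(2,3)])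
    then have "k * (jac h z * Qf u v (mob h z)) > 0"
      using z(2) mob_Re_Im(1)[OF assms(6) z(1)] by simp
    then show ?thesis
      unfolding Qf_mob_inv[OF assms(6) z(1)] z(3) wd_matrix_inv[OF assms(6)] .
  qed
  then show "?X \<ge> 0" "?Y \<ge> 0"
    using pos_combination_zero[of ?X ?Y] by (simp_all add: less_imp_le)
  show "?X + ?Y > 0" using pos[of 1 1] by simp
qed

text \<open>Pulled back by \<open>g\<close> or \<open>g'\<close>, the hypotheses on the translates
  describe the position of \<open>h L'\<close> relative to \<open>L\<close> and of
  \<open>h\<^sup>-\<^sup>1 L\<close> relative to \<open>L'\<close>. This gives the signs in the
  columns and in the rows of the matrix of pairings with \<open>h\<close>.\<close>

lemma stem_quadrants_imp_translates_disjoint: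
  assumes L: "p \<noteq> q" "L = geod p q" and L': "p' \<noteq> q'" "L' = geod p' q'"
    and g: "g \<in> SL2" "g' \<in> SL2"
    and dis: "L \<inter> L' = {}" "mob g ` L \<inter> mob g' ` L' = {}"
    and aw: "mob g ` away L L' = away (mob g ` L) (mob g' ` L')" "mob g' ` away L' L = away (mob g' ` L') (mob g ` L)"
    and mem: "matrix_inv g ** g' \<in> setmul (SQ L (away L L')) (setinv (SQ L' (away L' L)))"
  shows "translate g (Cstar L) \<inter> translate g' (Cstar L') = {}"
proof -
  define h where "h = matrix_inv g ** g'"
  have h: "h \<in> SL2" using g by (simp add: h_def SL2_mult matrix_inv_SL2)
  have gh: "g ** h = g'" by (simp add: h_def matrix_mul_assoc matrix_inv_SL2(2)[OF g(1)])
  obtain u v x y where l: "lift p u" "lift q v" "lift p' x" "lift q' y"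
    and m: "wd u x \<ge> 0" "wd u y \<ge> 0" "wd v x \<ge> 0" "wd v y \<ge> 0"
    "wd u x * wd v x + wd u y * wd v y > 0" "wd u x * wd u y + wd v x * wd v y > 0"
    using disjoint_geods_frames[of p q p' q'] dis(1) L L' by blast
  have aL: "away L L' = {z \<in> H2. Qf u v z < 0}"
    unfolding L(2) L'(2) by (rule away_frames[OF L(1) L'(1) l]) (use m in auto)
  have aL': "away L' L = {z \<in> H2. Qf x y z < 0}"
    unfolding L(2) L'(2) by (rule away_frames[OF L'(1) L(1) l(3,4,1,2)])
      (use m in \<open>simp_all add: wd_swap[of x] wd_swap[of y]\<close>)
  have LH: "L \<subseteq> H2" "L' \<subseteq> H2" by (auto simp: L(2) L'(2) geod_bd_vec)
  \<comment> \<open>By definition the side pointing away from a geodesic does not meet it;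
    \<open>aw\<close> transfers this to the translates.\<close>
  have out: "mob g ` away L L' \<inter> mob g' ` L' = {}" "mob g' ` away L' L \<inter> mob g ` L = {}"
    unfolding aw by (auto simp: away_def)
  have 1: "mob h z \<notin> L \<and> mob h z \<notin> away L L'" if "z \<in> L'" for z
  proof -
    have "mob g (mob h z) = mob g' z" using mob_mult[OF g(1) h, of z] that LH by (auto simp: gh)
    then show ?thesis using that dis(2) out(1) by (metis IntI empty_iff imageI)
  qed
  have hi: "matrix_inv h \<in> SL2" by (rule matrix_inv_SL2(3)[OF h])
  have 2: "mob (matrix_inv h) z \<notin> L' \<and> mob (matrix_inv h) z \<notin> away L' L" if "z \<in> L" for z
  proof -
    have zH: "z \<in> H2" using that LH by blast
    have "mob g' (mob (matrix_inv h) z) = mob g (mob h (mob (matrix_inv h) z))"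
      using mob_mult[OF g(1) h mob_H2[OF hi zH]] by (simp add: gh)
    also have "\<dots> = mob g z" using mob_inv[OF h zH] by simp
    finally show ?thesis using that dis(2) out(2) by (metis IntI empty_iff imageI)
  qed
  have 1: "z \<in> geod p' q' \<Longrightarrow> mob h z \<notin> geod p q" "z \<in> geod p' q' \<Longrightarrow> mob h z \<notin> {z \<in> H2. Qf u v z < 0}" for z
    using 1[of z] unfolding aL unfolding L(2) L'(2) by simp_all
  have 2: "z \<in> geod p q \<Longrightarrow> mob (matrix_inv h) z \<notin> geod p' q'"
    "z \<in> geod p q \<Longrightarrow> mob (matrix_inv h) z \<notin> {z \<in> H2. Qf x y z < 0}" for z
    using 2[of z] unfolding aL' unfolding L(2) L'(2) by simp_all
  note n1 = away_images_sign[OF L'(1) l h 1]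
  note n2 = away_images_sign[OF L(1) l(3,4,1,2) hi 2]
  \<comment> \<open>The minus signs cancel in products, so the conditions on
    \<open>matrix_inv h\<close> become conditions on the rows of pairings with
    \<open>h\<close>.\<close>
  have flip: "wd s (matrix_inv h *v r) = - wd r (h *v s)" for s r
    by (simp add: wd_swap[of s] wd_matrix_inv[OF h])
  obtain A B where AB: "A \<in> SQ L (away L L')" "B \<in> SQ L' (away L' L)" "h = A ** matrix_inv B"
    using mem unfolding h_def setmul_def setinv_def by blast
  have "B \<in> SL2" using AB(2) by (simp add: SQ_def)
  then have hB: "h ** B = A" by (simp add: AB(3) matrix_mul_assoc[symmetric] matrix_inv_SL2(1))
  have SQ: "A \<in> SQ (geod p q) {z \<in> H2. Qf u v z < 0}" "B \<in> SQ (geod p' q') {z \<in> H2. Qf x y z < 0}"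
    using AB(1,2) unfolding aL aL' unfolding L(2) L'(2) .
  have n3: "wd u (h *v x) * wd u (h *v y) \<ge> 0" "wd v (h *v x) * wd v (h *v y) \<ge> 0"
    using n2(1,2) unfolding flip by simp_all
  have dom: "(wd u (h *v x))\<^sup>2 < (wd u x)\<^sup>2" "(wd u (h *v y))\<^sup>2 < (wd u y)\<^sup>2"
    "(wd v (h *v x))\<^sup>2 < (wd v x)\<^sup>2" "(wd v (h *v y))\<^sup>2 < (wd v y)\<^sup>2"
    using stem_quadrants_dominate[OF L(1) L'(1) l h SQ hB n1 n3] by simp_all
  show ?thesis
  proof (rule ccontr)
    assume "translate g (Cstar L) \<inter> translate g' (Cstar L') \<noteq> {}"
    then obtain C D where CD: "C \<in> Cstar L" "D \<in> Cstar L'" "g ** C = g' ** D" unfolding translate_def by blast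
    have "C = matrix_inv g ** (g ** C)" by (simp add: matrix_mul_assoc matrix_inv_SL2(1)[OF g(1)])
    then have "C = h ** D" unfolding CD(3) by (simp add: h_def matrix_mul_assoc)
    then show False
      using Cstar_disjoint[OF L(1) L'(1) l h dom] CD(1,2) L(2) L'(2) by blast
  qed
qed

subsection \<open>From disjointness to the stem quadrants\<close>

text \<open>If the bound fails, let \<open>A\<close> scale \<open>v\<close> by the factor
  \<open>k\<close> that gives determinant 1 together with \<open>A *v w = h *v w\<close>. Then
  \<open>|k| \<le> 1\<close> and \<open>h\<^sup>-\<^sup>1 A\<close> fixes \<open>w\<close>, so
  \<open>A\<close> is a common element.\<close>

lemma Cstar_ideal_pair:
  assumes "p \<noteq> q" "p' \<noteq> q'" "h \<in> SL2" "\<xi> \<in> {p, q}" "\<eta> \<in> {p', q'}" "\<xi> \<noteq> \<eta>" "lift \<xi> v" "lift \<eta> w"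
    and dis: "\<And>A B. A \<in> Cstar (geod p q) \<Longrightarrow> B \<in> Cstar (geod p' q') \<Longrightarrow> A \<noteq> h ** B"
  shows "(wd v (h *v w))\<^sup>2 < (wd v w)\<^sup>2"
proof (rule ccontr)
  let ?n = "wd v (h *v w)" and ?m = "wd v w"
  assume "\<not> ?n\<^sup>2 < ?m\<^sup>2"
  then have le: "\<bar>?m\<bar> \<le> \<bar>?n\<bar>" by (simp add: abs_le_square_iff)
  have m: "?m \<noteq> 0" using wd_lift[OF assms(7,8)] assms(6) by blast
  then have n: "?n \<noteq> 0" using le by auto
  define k where "k = ?m / ?n"
  have k: "\<bar>k\<bar> \<le> 1" using le n by (simp add: k_def)
  obtain A where A: "A *v v = k *\<^sub>R v" "A *v w = h *v w" using mat_on_basis_exists[OF m] .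
  have "wd (k *\<^sub>R v) (h *v w) = wd v w" using n by (simp add: k_def)
  then have S: "A \<in> SL2" using SL2_on_basis[OF m A] by blast
  have B: "(matrix_inv h ** A) *v w = 1 *\<^sub>R w"
    by (simp add: matrix_vector_mul_assoc[symmetric] A(2)) (simp add: matrix_vector_mul_assoc matrix_inv_SL2(1)[OF assms(3)])
  have "A \<in> Cstar (geod p q)" by (rule Cstar_idealI[OF assms(1,4,7) S A(1) k])
  moreover have "matrix_inv h ** A \<in> Cstar (geod p' q')"
    by (rule Cstar_idealI[OF assms(2,5,8) _ B]) (simp_all add: SL2_mult matrix_inv_SL2 assms(3) S)
  moreover have "A = h ** (matrix_inv h ** A)" by (simp add: matrix_mul_assoc matrix_inv_SL2(2)[OF assms(3)])
  ultimately show False using dis by blast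
qed

text \<open>At a common endpoint \<open>\<xi>\<close> there is always an intersection: if \<open>h\<close> fixes \<open>\<xi>\<close>, both factors can
contract the line over \<open>\<xi>\<close>; otherwise an elliptic element centred on the first line close to \<open>\<xi>\<close>
moves \<open>\<xi>\<close> to \<open>h \<xi>\<close>.\<close>
lemma Cstar_common_endpoint:
  assumes "\<xi> \<noteq> \<eta>" "\<xi> \<noteq> \<eta>'" "h \<in> SL2"
  shows "\<exists>A\<in>Cstar (geod \<xi> \<eta>). \<exists>B\<in>Cstar (geod \<xi> \<eta>'). A = h ** B"
proof -
  let ?v = "bd_vec \<xi>" and ?u = "bd_vec \<eta>"
  have nz: "wd ?v ?u \<noteq> 0" using wd_lift[OF lift_bd_vec lift_bd_vec] assms(1) by blast
  have v0: "?v \<noteq> 0" by (rule lift_nonzero[OF lift_bd_vec])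
  have hi: "matrix_inv h \<in> SL2" by (rule matrix_inv_SL2(3)[OF assms(3)])
  show ?thesis
  proof (cases "wd ?v (h *v ?v) = 0")
    case True
    then obtain l where l: "h *v ?v = l *\<^sub>R ?v" using wd_zero_imp_parallel v0 by blast
    \<comment> \<open>Chosen so that both \<open>k\<close> and \<open>k * l\<close>, the eigenvalues
      of \<open>B\<close> and \<open>h ** B\<close> over the common endpoint, have modulus at most
      1.\<close>
    define k where "k = (if \<bar>l\<bar> \<le> 1 then 1 else 1 / \<bar>l\<bar>)"
    have k: "k \<noteq> 0" "\<bar>k\<bar> \<le> 1" "\<bar>k * l\<bar> \<le> 1" by (auto simp: k_def abs_mult)
    obtain B where B: "B *v ?v = k *\<^sub>R ?v" "B *v ?u = (1 / k) *\<^sub>R ?u" using mat_on_basis_exists[OF nz] .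
    have S: "B \<in> SL2" using SL2_on_basis[OF nz B] k(1) by simp
    have A: "(h ** B) *v ?v = (k * l) *\<^sub>R ?v"
      by (simp add: matrix_vector_mul_assoc[symmetric] B(1) matrix_vector_mult_scaleR l)
    have "B \<in> Cstar (geod \<xi> \<eta>')"
      by (rule Cstar_idealI[OF assms(2) _ lift_bd_vec S B(1) k(2)]) simp
    moreover have "h ** B \<in> Cstar (geod \<xi> \<eta>)"
      by (rule Cstar_idealI[OF assms(1) _ lift_bd_vec SL2_mult[OF assms(3) S] A k(3)]) simp
    ultimately show ?thesis by blast
  next
    case False
    obtain a b where hv: "h *v ?v = a *\<^sub>R ?v + b *\<^sub>R ?u" using wd_basis[OF nz] .
    have b: "b \<noteq> 0" using False hv by auto
    \<comment> \<open>Together with \<open>r\<close> this makes the determinant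
      \<open>k * k * (a * a + r * (b * b))\<close> of \<open>A\<close> equal to 1. As
      \<open>A\<close> sends \<open>?v\<close> to \<open>k\<close> times \<open>h *v ?v\<close>, the
      other factor has eigenvalue \<open>k\<close> at \<open>?v\<close>, of modulus at most
      1.\<close>
    define k where "k = 1 / sqrt (a\<^sup>2 + 1)"
    have pos: "a\<^sup>2 + 1 > 0" by (simp add: add_nonneg_pos)
    have kk: "k * k * (a * a + 1) = 1"
      using pos by (simp add: k_def power_divide power2_eq_square[symmetric])
    have "sqrt (a\<^sup>2 + 1) \<ge> 1" by simp
    then have k: "\<bar>k\<bar> \<le> 1" using pos by (simp add: k_def divide_le_eq_1)
    define r where "r = 1 / (b * b)"
    have r: "r > 0" using b by (simp add: r_def zero_less_mult_iff linorder_neq_iff disj_commute)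
    obtain A where A: "A *v ?v = (k * a) *\<^sub>R ?v + (k * b) *\<^sub>R ?u" "A *v ?u = - (r * (k * b)) *\<^sub>R ?v + (k * a) *\<^sub>R ?u"
      using mat_on_basis_exists[OF nz] .
    have "wd ((k * a) *\<^sub>R ?v + (k * b) *\<^sub>R ?u) (- (r * (k * b)) *\<^sub>R ?v + (k * a) *\<^sub>R ?u)
      = (k * k * (a * a + r * (b * b))) * wd ?v ?u"
      by (simp add: wd_swap[of ?u ?v] algebra_simps)
    moreover have "r * (b * b) = 1" using b by (simp add: r_def)
    ultimately have S: "A \<in> SL2" using SL2_on_basis[OF nz A] kk by simp
    have "A *v ?v = k *\<^sub>R (h *v ?v)" by (simp add: A(1) hv scaleR_add_right)
    then have B: "(matrix_inv h ** A) *v ?v = k *\<^sub>R ?v"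
      by (simp add: matrix_vector_mul_assoc[symmetric] matrix_vector_mult_scaleR)
        (simp add: matrix_vector_mul_assoc matrix_inv_SL2(1)[OF assms(3)])
    have "A \<in> Cstar (geod \<xi> \<eta>)"
      by (rule Cstar_interiorI[OF assms(1) lift_bd_vec lift_bd_vec S r A])
    moreover have "matrix_inv h ** A \<in> Cstar (geod \<xi> \<eta>')"
      by (rule Cstar_idealI[OF assms(2) _ lift_bd_vec SL2_mult[OF hi S] B k]) simp
    moreover have "A = h ** (matrix_inv h ** A)" by (simp add: matrix_mul_assoc matrix_inv_SL2(2)[OF assms(3)])
    ultimately show ?thesis by blast
  qed
qed

text \<open>The forms of two points \<open>z\<close>, \<open>w\<close> pair to
  \<open>2 * Im z * Im w\<close> times the hyperbolic cosine of their distance. With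
  \<open>w = h\<^sup>-\<^sup>1 z\<close> and the heights normalised by \<open>jac h w\<close>, the
  claim is that this cosine is at least 1.\<close>

lemma crossing_pairing:
  assumes "z \<in> H2" "h \<in> SL2" "s \<ge> 0" "t \<ge> 0"
    and x: "\<And>a b. Qf a b z = s * (wd a x * wd b x) + t * (wd a y * wd b y)"
  shows "s * Qf x x z + t * Qf y y z \<le> s * Qf (h *v x) (h *v x) z + t * Qf (h *v y) (h *v y) z"
proof -
  have e: "s * (x$2)\<^sup>2 + t * (y$2)\<^sup>2 = 1" "s * (x$1 * x$2) + t * (y$1 * y$2) = Re z"
    "s * (x$1)\<^sup>2 + t * (y$1)\<^sup>2 = (Re z)\<^sup>2 + (Im z)\<^sup>2"
    using x[of "bd_vec None" "bd_vec None"] x[of "bd_vec None" "bd_vec (Some 0)"] x[of "bd_vec (Some 0)" "bd_vec (Some 0)"]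
    by (simp_all add: Qf_def wd_def power2_eq_square algebra_simps)
  have pair: "s * Qf x x w + t * Qf y y w = (Re z - Re w)\<^sup>2 + (Im z)\<^sup>2 + (Im w)\<^sup>2" for w
  proof -
    have "s * Qf x x w + t * Qf y y w = (s * (x$1)\<^sup>2 + t * (y$1)\<^sup>2)
       - 2 * (s * (x$1 * x$2) + t * (y$1 * y$2)) * Re w
       + (s * (x$2)\<^sup>2 + t * (y$2)\<^sup>2) * ((Re w)\<^sup>2 + (Im w)\<^sup>2)"
      by (simp add: Qf_def power2_eq_square algebra_simps)
    then show ?thesis unfolding e by (simp add: power2_eq_square algebra_simps)
  qed
  define w where "w = mob (matrix_inv h) z"
  have w: "w \<in> H2" unfolding w_def using mob_H2 matrix_inv_SL2(3) assms(1,2) by blast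
  have hw: "mob h w = z" unfolding w_def by (rule mob_inv[OF assms(2,1)])
  have j: "jac h w > 0" "jac h w * Im z = Im w" using mob_Re_Im(1,2)[OF assms(2) w] hw by simp_all
  have "jac h w * (s * Qf (h *v x) (h *v x) z + t * Qf (h *v y) (h *v y) z)
    = s * (jac h w * Qf (h *v x) (h *v x) (mob h w)) + t * (jac h w * Qf (h *v y) (h *v y) (mob h w))"
    by (simp add: hw algebra_simps)
  also have "\<dots> = s * Qf x x w + t * Qf y y w" unfolding Qf_mob[OF assms(2) w] ..
  also have "\<dots> \<ge> 2 * Im z * Im w"
    unfolding pair using sum_squares_bound[of "Im z" "Im w"] zero_le_power2[of "Re z - Re w"] by linarith
  also have "2 * Im z * Im w = jac h w * (s * Qf x x z + t * Qf y y z)"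
    unfolding pair j(2)[symmetric] by (simp add: power2_eq_square)
  finally show ?thesis using j(1) by simp
qed

text \<open>At a crossing point the bounds, summed with the positive weights of the point on both
  geodesics, would contradict \<open>crossing_pairing\<close>.\<close>

lemma contracted_frames_imp_geods_disjoint:
  assumes "p \<noteq> q" "p' \<noteq> q'" "lift p u" "lift q v" "lift p' x" "lift q' y" "h \<in> SL2"
    and n: "(wd u (h *v x))\<^sup>2 < (wd u x)\<^sup>2" "(wd u (h *v y))\<^sup>2 < (wd u y)\<^sup>2"
      "(wd v (h *v x))\<^sup>2 < (wd v x)\<^sup>2" "(wd v (h *v y))\<^sup>2 < (wd v y)\<^sup>2"
  shows "geod p q \<inter> geod p' q' = {}"
proof (rule ccontr)
  assume "geod p q \<inter> geod p' q' \<noteq> {}"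
  then obtain z where z: "z \<in> H2" "Qf u v z = 0" "Qf x y z = 0"
    by (auto simp: geod_Qf[OF assms(3,4)] geod_Qf[OF assms(5,6)])
  have nz: "wd u v \<noteq> 0" "wd x y \<noteq> 0" using assms wd_lift by blast+
  obtain s t where st: "s > 0" "t > 0" "\<And>a b. Qf a b z = s * (wd a u * wd b u) + t * (wd a v * wd b v)"
    using geod_point_decomp[OF nz(1) z(1,2)] by blast
  obtain s' t' where st': "s' > 0" "t' > 0" "\<And>a b. Qf a b z = s' * (wd a x * wd b x) + t' * (wd a y * wd b y)"
    using geod_point_decomp[OF nz(2) z(1,3)] by blast
  have Q: "Qf a a z = s * (wd u a)\<^sup>2 + t * (wd v a)\<^sup>2" for a
    unfolding st(3) by (simp add: wd_swap[of a] power2_eq_square)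
  have lt: "Qf (h *v x) (h *v x) z < Qf x x z" "Qf (h *v y) (h *v y) z < Qf y y z"
    unfolding Q using st(1,2) n by (simp_all add: add_strict_mono)
  have "s' * Qf (h *v x) (h *v x) z < s' * Qf x x z" "t' * Qf (h *v y) (h *v y) z < t' * Qf y y z"
    using lt st'(1,2) by simp_all
  then show False
    using crossing_pairing[OF z(1) assms(7) less_imp_le[OF st'(1)] less_imp_le[OF st'(2)] st'(3)]
    by linarith
qed

text \<open>The stem translations \<open>x + c y, y + d x\<close> and \<open>u - a v, v - b u\<close> are normalised to have the same
trace; this turns the four equations below into a uniquely solvable linear system.\<close>
lemma stem_system_solvable:
  fixes m11 m12 m21 m22 n11 n12 n21 n22 :: real
  assumes n: "\<bar>n11\<bar> < m11" "\<bar>n12\<bar> < m12" "\<bar>n21\<bar> < m21" "\<bar>n22\<bar> < m22"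
    and det: "n11 * n22 - n12 * n21 = m11 * m22 - m12 * m21"
    and small: "(m11 - n11) * (m12 - n12) * ((m21 - n21) * (m22 - n22)) < (m12 * m21 - n12 * n21)\<^sup>2"
  obtains a b c d where "a > 0" "b > 0" "c > 0" "d > 0" "a * b < 1" "c * d = a * b"
    "n11 + c * n12 = m11 - a * m21" "n12 + d * n11 = m12 - a * m22"
    "n21 + c * n22 = m21 - b * m11" "n22 + d * n21 = m22 - b * m12"
proof -
  \<comment> \<open>Equality of the determinants gives \<open>D\<close> a second expression
    \<open>D'\<close>; the equations for \<open>n11\<close> and \<open>n22\<close> are checked with
    the first, those for \<open>n12\<close> and \<open>n21\<close> with the second. The hypothesis
    \<open>small\<close> amounts to \<open>a * b < 1\<close>.\<close>
  define D where "D = m12 * m21 - n12 * n21"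
  have D': "D = m11 * m22 - n11 * n22" using det by (simp add: D_def)
  have "\<bar>n12 * n21\<bar> < m12 * m21" using n unfolding abs_mult by (intro mult_strict_mono) auto
  then have D: "D > 0" by (simp add: D_def abs_less_iff)
  define a where "a = (m11 - n11) * (m12 - n12) / D"
  define b where "b = (m21 - n21) * (m22 - n22) / D"
  define c where "c = (m11 - n11) * (m21 - n21) / D"
  define d where "d = (m12 - n12) * (m22 - n22) / D"
  have "a > 0" "b > 0" "c > 0" "d > 0" using D n by (simp_all add: a_def b_def c_def d_def abs_less_iff)
  moreover have "a * b < 1" using small D by (simp add: a_def b_def D_def[symmetric] power2_eq_square)
  moreover have "c * d = a * b" by (simp add: a_def b_def c_def d_def)
  moreover have "n11 + c * n12 = m11 - a * m21"
  proof -
    have "c * n12 + a * m21 = (m11 - n11) * D / D"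
      by (simp add: a_def c_def D_def add_divide_distrib[symmetric] algebra_simps)
    then show ?thesis using D by simp
  qed
  moreover have "n12 + d * n11 = m12 - a * m22"
  proof -
    have "d * n11 + a * m22 = (m12 - n12) * (m11 * m22 - n11 * n22) / D"
      by (simp add: a_def d_def add_divide_distrib[symmetric] algebra_simps)
    then show ?thesis using D by (simp add: D'[symmetric])
  qed
  moreover have "n21 + c * n22 = m21 - b * m11"
  proof -
    have "c * n22 + b * m11 = (m21 - n21) * (m11 * m22 - n11 * n22) / D"
      by (simp add: b_def c_def add_divide_distrib[symmetric] algebra_simps)
    then show ?thesis using D by (simp add: D'[symmetric])
  qed
  moreover have "n22 + d * n21 = m22 - b * m12"
  proof -
    have "d * n21 + b * m12 = (m22 - n22) * D / D"
      by (simp add: b_def d_def D_def add_divide_distrib[symmetric] algebra_simps)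
    then show ?thesis using D by simp
  qed
  ultimately show ?thesis by (rule that)
qed

lemma mult_le_imp_eq:
  fixes a b x y :: real
  assumes "0 < a" "0 < b" "a \<le> x" "b \<le> y" "x * y \<le> a * b"
  shows "x = a \<and> y = b"
proof -
  have "(x - a) * y \<ge> 0" "a * (y - b) \<ge> 0" using assms by simp_all
  moreover have "(x - a) * y + a * (y - b) \<le> 0" using assms(5) by (simp add: algebra_simps)
  ultimately have "(x - a) * y = 0" "a * (y - b) = 0" by linarith+
  then show ?thesis using assms(1,2,4) by auto
qed

text \<open>The alternatives belong to the two lifts \<open>h\<close> and \<open>-h\<close>. If both
  failed, \<open>?P * ?Q = X * Y\<close> with \<open>X\<close> and \<open>Y\<close> at most
  \<open>D\<^sup>2\<close> would force equality throughout. Then \<open>n11\<close>,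
  \<open>n22\<close> are \<open>f\<close> times and \<open>n12\<close>, \<open>n21\<close> are
  \<open>g\<close> times the entries \<open>m\<close>; \<open>?P = ?Q\<close> gives
  \<open>g = - f\<close>, and the determinants give \<open>f * f = 1\<close>, against
  \<open>|f| < 1\<close>.\<close>

lemma stem_system_small:
  fixes m11 m12 m21 m22 n11 n12 n21 n22 :: real
  assumes n: "\<bar>n11\<bar> < m11" "\<bar>n12\<bar> < m12" "\<bar>n21\<bar> < m21" "\<bar>n22\<bar> < m22"
    and det: "n11 * n22 - n12 * n21 = m11 * m22 - m12 * m21" "m11 * m22 - m12 * m21 \<noteq> 0"
  shows "(m11 - n11) * (m12 - n12) * ((m21 - n21) * (m22 - n22)) < (m12 * m21 - n12 * n21)\<^sup>2 \<or>
    (m11 + n11) * (m12 + n12) * ((m21 + n21) * (m22 + n22)) < (m12 * m21 - n12 * n21)\<^sup>2"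
proof (rule ccontr)
  let ?P = "(m11 - n11) * (m12 - n12) * ((m21 - n21) * (m22 - n22))"
  let ?Q = "(m11 + n11) * (m12 + n12) * ((m21 + n21) * (m22 + n22))"
  define D where "D = m12 * m21 - n12 * n21"
  have D': "D = m11 * m22 - n11 * n22" using det by (simp add: D_def)
  have "\<bar>n12 * n21\<bar> < m12 * m21" using n unfolding abs_mult by (intro mult_strict_mono) auto
  then have D: "D > 0" by (simp add: D_def abs_less_iff)
  \<comment> \<open>\<open>?P * ?Q\<close> regrouped by matching factors \<open>m - n\<close> and
    \<open>m + n\<close>.\<close>
  define X where "X = (m12\<^sup>2 - n12\<^sup>2) * (m21\<^sup>2 - n21\<^sup>2)"
  define Y where "Y = (m11\<^sup>2 - n11\<^sup>2) * (m22\<^sup>2 - n22\<^sup>2)"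
  have X: "X = D\<^sup>2 - (m12 * n21 - n12 * m21)\<^sup>2"
    unfolding X_def D_def by (simp add: power2_eq_square algebra_simps)
  have Y: "Y = D\<^sup>2 - (m11 * n22 - n11 * m22)\<^sup>2"
    unfolding Y_def D' by (simp add: power2_eq_square algebra_simps)
  have XY: "X > 0" "Y > 0"
  proof -
    have "a\<^sup>2 < b\<^sup>2" if "\<bar>a\<bar> < b" for a b :: real
      using power_strict_mono[OF that, of 2] by simp
    then show "X > 0" "Y > 0" using n by (simp_all add: X_def Y_def)
  qed
  assume "\<not> (?P < (m12 * m21 - n12 * n21)\<^sup>2 \<or> ?Q < (m12 * m21 - n12 * n21)\<^sup>2)"
  then have PQ: "?P \<ge> D\<^sup>2" "?Q \<ge> D\<^sup>2" by (simp_all add: D_def)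
  have prod: "?P * ?Q = X * Y" by (simp add: X_def Y_def power2_eq_square algebra_simps)
  have D2: "D\<^sup>2 > 0" using D by simp
  have ge: "D\<^sup>2 * D\<^sup>2 \<le> X * Y" unfolding prod[symmetric]
    by (rule mult_mono) (use PQ D2 in linarith)+
  have le: "X \<le> D\<^sup>2" "Y \<le> D\<^sup>2" unfolding X Y by simp_all
  have eq: "X = D\<^sup>2" "Y = D\<^sup>2"
    using mult_le_imp_eq[OF XY le ge] by simp_all
  have z: "m12 * n21 = n12 * m21" "m11 * n22 = n11 * m22" using X Y eq by simp_all
  have mp: "m11 > 0" "m12 > 0" "m21 > 0" "m22 > 0" using n by (simp_all add: abs_less_iff)
  define f where "f = n11 / m11"
  define g where "g = n12 / m12"
  have f: "n11 = f * m11" "n22 = f * m22" using z(2) mp by (simp_all add: f_def field_simps)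
  have g: "n12 = g * m12" "n21 = g * m21" using z(1) mp by (simp_all add: g_def field_simps)
  have f1: "\<bar>f\<bar> < 1" using n(1) mp by (simp add: f_def)
  have g1: "\<bar>g\<bar> < 1" using n(2) mp by (simp add: g_def)
  let ?m = "m11 * m12 * (m21 * m22)"

  have P: "?P = ((1 - f) * (1 - g))\<^sup>2 * ?m" unfolding f g by (simp add: power2_eq_square algebra_simps)
  have Q: "?Q = ((1 + f) * (1 + g))\<^sup>2 * ?m" unfolding f g by (simp add: power2_eq_square algebra_simps)
  have "?P * ?Q = D\<^sup>2 * D\<^sup>2" unfolding prod eq ..
  then have "?P = ?Q"
    using mult_le_imp_eq[OF D2 D2 PQ] by auto
  then have "((1 - f) * (1 - g))\<^sup>2 = ((1 + f) * (1 + g))\<^sup>2" unfolding P Q using mp by simp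
  then have "(1 - f) * (1 - g) = (1 + f) * (1 + g)" using f1 g1 by (simp add: power2_eq_iff_nonneg)
  then have gf: "g = - f" by (simp add: algebra_simps)
  have "(1 - f * f) * (m11 * m22 - m12 * m21) = 0"
    using det(1) unfolding f g gf by (simp add: algebra_simps)
  then have "f * f = 1" using det(2) by simp
  then have "\<bar>f\<bar> = 1" by (metis abs_1 abs_mult_self_eq power2_eq_1_iff power2_eq_square abs_minus_cancel)
  then show False using f1 by simp
qed

lemma stem_quadrant_factorisation:
  assumes "p \<noteq> q" "p' \<noteq> q'" "lift p u" "lift q v" "lift p' x" "lift q' y" "h \<in> SL2"
    and n: "\<bar>wd u (h *v x)\<bar> < wd u x" "\<bar>wd u (h *v y)\<bar> < wd u y"
      "\<bar>wd v (h *v x)\<bar> < wd v x" "\<bar>wd v (h *v y)\<bar> < wd v y"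
  shows "\<exists>A\<in>SQ (geod p q) {z \<in> H2. Qf u v z < 0}. \<exists>B\<in>SQ (geod p' q') {z \<in> H2. Qf x y z < 0}. h ** B = A"
proof -
  have nz: "wd u v \<noteq> 0" "wd x y \<noteq> 0" using assms wd_lift by blast+
  \<comment> \<open>The Pluecker relation: both 2 by 2 determinants of pairings equal
    \<open>wd u v * wd x y\<close>.\<close>
  have pl: "wd u r * wd v s - wd u s * wd v r = wd u v * wd r s" for r s
    by (simp add: wd_def algebra_simps)
  have det: "wd u (h *v x) * wd v (h *v y) - wd u (h *v y) * wd v (h *v x) = wd u x * wd v y - wd u y * wd v x"
    unfolding pl wd_SL2[OF assms(7)] ..
  have det0: "wd u x * wd v y - wd u y * wd v x \<noteq> 0" unfolding pl using nz by simp
  \<comment> \<open>\<open>e\<close> selects the lift, \<open>h\<close> or \<open>-h\<close>, for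
    which the linear system has a solution with \<open>a * b < 1\<close>.\<close>
  obtain e where e: "e = 1 \<or> e = (-1::real)" and
    small: "(wd u x - e * wd u (h *v x)) * (wd u y - e * wd u (h *v y)) * ((wd v x - e * wd v (h *v x)) * (wd v y - e * wd v (h *v y)))
      < (wd u y * wd v x - wd u (h *v y) * wd v (h *v x))\<^sup>2"
    using stem_system_small[OF n det det0]
  proof
    assume "(wd u x - wd u (h *v x)) * (wd u y - wd u (h *v y)) * ((wd v x - wd v (h *v x)) * (wd v y - wd v (h *v y)))
      < (wd u y * wd v x - wd u (h *v y) * wd v (h *v x))\<^sup>2"
    then show ?thesis using that[of 1] by simp
  next
    assume "(wd u x + wd u (h *v x)) * (wd u y + wd u (h *v y)) * ((wd v x + wd v (h *v x)) * (wd v y + wd v (h *v y)))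
      < (wd u y * wd v x - wd u (h *v y) * wd v (h *v x))\<^sup>2"
    then show ?thesis using that[of "-1"] by simp
  qed
  have en: "\<bar>e * wd u (h *v x)\<bar> < wd u x" "\<bar>e * wd u (h *v y)\<bar> < wd u y"
      "\<bar>e * wd v (h *v x)\<bar> < wd v x" "\<bar>e * wd v (h *v y)\<bar> < wd v y"
      "e * wd u (h *v x) * (e * wd v (h *v y)) - e * wd u (h *v y) * (e * wd v (h *v x)) = wd u x * wd v y - wd u y * wd v x"
      "(wd u x - e * wd u (h *v x)) * (wd u y - e * wd u (h *v y)) * ((wd v x - e * wd v (h *v x)) * (wd v y - e * wd v (h *v y)))
      < (wd u y * wd v x - e * wd u (h *v y) * (e * wd v (h *v x)))\<^sup>2"
    using n det small e by auto
  obtain a b c d where abcd: "a > 0" "b > 0" "c > 0" "d > 0" "a * b < 1" "c * d = a * b"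
    and eq: "e * wd u (h *v x) + c * (e * wd u (h *v y)) = wd u x - a * wd v x"
      "e * wd u (h *v y) + d * (e * wd u (h *v x)) = wd u y - a * wd v y"
      "e * wd v (h *v x) + c * (e * wd v (h *v y)) = wd v x - b * wd u x"
      "e * wd v (h *v y) + d * (e * wd v (h *v x)) = wd v y - b * wd u y"
    using stem_system_solvable[OF en] .
  have ee: "e * e = 1" using e by auto
  \<comment> \<open>Normalises both determinants to 1 at once, because
    \<open>c * d = a * b\<close>.\<close>
  define r where "r = 1 / sqrt (1 - a * b)"
  have r: "r > 0" "r * r * (1 - a * b) = 1" using abcd(5) by (simp_all add: r_def)
  \<comment> \<open>The sign \<open>e\<close> goes into \<open>A\<close>, where it cancels in the
    products that \<open>SQ_geodI\<close> requires to be positive.\<close>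
  obtain A where A: "A *v u = (e * r) *\<^sub>R u + (e * r * a) *\<^sub>R v" "A *v v = (e * r * b) *\<^sub>R u + (e * r) *\<^sub>R v"
    using mat_on_basis_exists[OF nz(1)] .
  obtain B where B: "B *v x = r *\<^sub>R x + (r * c) *\<^sub>R y" "B *v y = (r * d) *\<^sub>R x + r *\<^sub>R y"
    using mat_on_basis_exists[OF nz(2)] .
  have SA: "A \<in> SL2"
  proof (rule SL2_on_basis[OF nz(1) A])
    have "wd ((e * r) *\<^sub>R u + (e * r * a) *\<^sub>R v) ((e * r * b) *\<^sub>R u + (e * r) *\<^sub>R v)
      = (e * e) * (r * r * (1 - a * b)) * wd u v"
      by (simp add: wd_swap[of v u] algebra_simps)
    then show "wd ((e * r) *\<^sub>R u + (e * r * a) *\<^sub>R v) ((e * r * b) *\<^sub>R u + (e * r) *\<^sub>R v) = wd u v"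
      unfolding ee r(2) by simp
  qed
  have SB: "B \<in> SL2"
  proof (rule SL2_on_basis[OF nz(2) B])
    have "wd (r *\<^sub>R x + (r * c) *\<^sub>R y) ((r * d) *\<^sub>R x + r *\<^sub>R y) = (r * r * (1 - c * d)) * wd x y"
      by (simp add: wd_swap[of y x] algebra_simps)
    then show "wd (r *\<^sub>R x + (r * c) *\<^sub>R y) ((r * d) *\<^sub>R x + r *\<^sub>R y) = wd x y"
      unfolding abcd(6) r(2) by simp
  qed
  have "A \<in> SQ (geod p q) {z \<in> H2. Qf u v z < 0}"
  proof (rule SQ_geodI[OF assms(1,3,4) SA A])
    have 1: "e * r * (e * r * a) = (e * e) * (r * r * a)" "e * r * (e * r * b) = (e * e) * (r * r * b)"
      by (simp_all add: algebra_simps)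
    show "e * r * (e * r * a) > 0" "e * r * (e * r * b) > 0" unfolding 1 ee using r(1) abcd by simp_all
  qed
  moreover have "B \<in> SQ (geod p' q') {z \<in> H2. Qf x y z < 0}"
    by (rule SQ_geodI[OF assms(2,5,6) SB B]) (use r(1) abcd in simp_all)
  \<comment> \<open>Evaluated on \<open>x\<close>, \<open>y\<close> and paired with
    \<open>u\<close>, \<open>v\<close>, this is the system \<open>eq\<close> up to the factors
    \<open>e\<close> and \<open>r\<close>.\<close>
  moreover have "h ** B = A"
  proof (rule mat_eq_on_basis[OF nz(2)])
    have iA: "matrix_inv A *v u = (e * r) *\<^sub>R u - (e * r * a) *\<^sub>R v" "matrix_inv A *v v = (e * r) *\<^sub>R v - (e * r * b) *\<^sub>R u"
      using SL2_inv_on_basis[OF SA nz(1) A] by blast+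
    note hs = matrix_vector_mul_assoc[symmetric] matrix_vector_right_distrib matrix_vector_mult_scaleR
    have cancel: "s = t" if "e * s = t'" "t = e * t'" for s t t' :: real
      using that ee by (metis mult.assoc mult_1)
    show "(h ** B) *v x = A *v x"
    proof (rule vec_eq_by_wd[OF nz(1)])
      show "wd u ((h ** B) *v x) = wd u (A *v x)"
      proof (rule cancel)
        show "e * wd u ((h ** B) *v x) = r * (wd u x - a * wd v x)"
          unfolding eq[symmetric] by (simp add: hs B algebra_simps)
        show "wd u (A *v x) = e * (r * (wd u x - a * wd v x))"
          unfolding wd_matrix_inv[OF SA, symmetric] iA by (simp add: algebra_simps)
      qed
      show "wd v ((h ** B) *v x) = wd v (A *v x)"
      proof (rule cancel)
        show "e * wd v ((h ** B) *v x) = r * (wd v x - b * wd u x)"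
          unfolding eq[symmetric] by (simp add: hs B algebra_simps)
        show "wd v (A *v x) = e * (r * (wd v x - b * wd u x))"
          unfolding wd_matrix_inv[OF SA, symmetric] iA by (simp add: algebra_simps)
      qed
    qed
    show "(h ** B) *v y = A *v y"
    proof (rule vec_eq_by_wd[OF nz(1)])
      show "wd u ((h ** B) *v y) = wd u (A *v y)"
      proof (rule cancel)
        show "e * wd u ((h ** B) *v y) = r * (wd u y - a * wd v y)"
          unfolding eq[symmetric] by (simp add: hs B algebra_simps)
        show "wd u (A *v y) = e * (r * (wd u y - a * wd v y))"
          unfolding wd_matrix_inv[OF SA, symmetric] iA by (simp add: algebra_simps)
      qed
      show "wd v ((h ** B) *v y) = wd v (A *v y)"
      proof (rule cancel)
        show "e * wd v ((h ** B) *v y) = r * (wd v y - b * wd u y)"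
          unfolding eq[symmetric] by (simp add: hs B algebra_simps)
        show "wd v (A *v y) = e * (r * (wd v y - b * wd u y))"
          unfolding wd_matrix_inv[OF SA, symmetric] iA by (simp add: algebra_simps)
      qed
    qed
  qed
  ultimately show ?thesis by blast
qed

text \<open>Disjointness first excludes common endpoints, then yields the bounds at the four pairs
  of endpoints. These exclude a crossing and, in a frame with nonnegative pairings, give the
  factorisation.\<close>

lemma translates_disjoint_imp_stem_quadrants:
  assumes L: "p \<noteq> q" "L = geod p q" and L': "p' \<noteq> q'" "L' = geod p' q'"
    and g: "g \<in> SL2" "g' \<in> SL2"
    and dis: "translate g (Cstar L) \<inter> translate g' (Cstar L') = {}"
  shows "L \<inter> L' = {}"
    "matrix_inv g ** g' \<in> setmul (SQ L (away L L')) (setinv (SQ L' (away L' L)))"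
proof -
  define h where "h = matrix_inv g ** g'"
  have h: "h \<in> SL2" using g by (simp add: h_def SL2_mult matrix_inv_SL2)
  have gh: "g ** h = g'" by (simp add: h_def matrix_mul_assoc matrix_inv_SL2(2)[OF g(1)])
  have no: "A \<noteq> h ** B" if "A \<in> Cstar (geod p q)" "B \<in> Cstar (geod p' q')" for A B
  proof
    assume "A = h ** B"
    then have "g ** A = g' ** B" by (simp add: matrix_mul_assoc gh)
    then show False using dis that unfolding translate_def L(2) L'(2) by blast
  qed
  have "p \<noteq> p'" using Cstar_common_endpoint[of p q q' h] L(1) L'(1) h no by blast
  moreover have "p \<noteq> q'" using Cstar_common_endpoint[of p q p' h] L(1) L'(1) h no geod_commute[of p' q'] by metis
  moreover have "q \<noteq> p'" using Cstar_common_endpoint[of q p q' h] L(1) L'(1) h no geod_commute[of p q] by metis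
  moreover have "q \<noteq> q'" using Cstar_common_endpoint[of q p p' h] L(1) L'(1) h no geod_commute[of p q] geod_commute[of p' q'] by metis
  ultimately have ne: "p \<noteq> p'" "p \<noteq> q'" "q \<noteq> p'" "q \<noteq> q'" .
  \<comment> \<open>Stated for all lifts: it is used with \<open>bd_vec\<close> to obtain
    \<open>L \<inter> L' = {}\<close>, and then with the frame that this disjointness
    provides.\<close>
  have n: "(wd u (h *v x))\<^sup>2 < (wd u x)\<^sup>2" "(wd u (h *v y))\<^sup>2 < (wd u y)\<^sup>2"
      "(wd v (h *v x))\<^sup>2 < (wd v x)\<^sup>2" "(wd v (h *v y))\<^sup>2 < (wd v y)\<^sup>2"
    if "lift p u" "lift q v" "lift p' x" "lift q' y" for u v x y
    by (rule Cstar_ideal_pair[OF L(1) L'(1) h _ _ _ _ _ no]; use that ne in simp)+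
  show d: "L \<inter> L' = {}"
    unfolding L(2) L'(2)
    by (rule contracted_frames_imp_geods_disjoint[OF L(1) L'(1) _ _ _ _ h n]) (rule lift_bd_vec)+
  obtain u v x y where l: "lift p u" "lift q v" "lift p' x" "lift q' y"
    and m: "wd u x \<ge> 0" "wd u y \<ge> 0" "wd v x \<ge> 0" "wd v y \<ge> 0"
    "wd u x * wd v x + wd u y * wd v y > 0" "wd u x * wd u y + wd v x * wd v y > 0"
    using disjoint_geods_frames[of p q p' q'] d L L' by blast
  have aL: "away L L' = {z \<in> H2. Qf u v z < 0}"
    unfolding L(2) L'(2) by (rule away_frames[OF L(1) L'(1) l]) (use m in auto)
  have aL': "away L' L = {z \<in> H2. Qf x y z < 0}"
    unfolding L(2) L'(2) by (rule away_frames[OF L'(1) L(1) l(3,4,1,2)])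
      (use m in \<open>simp_all add: wd_swap[of x] wd_swap[of y]\<close>)
  have "\<bar>wd u (h *v x)\<bar> < wd u x" "\<bar>wd u (h *v y)\<bar> < wd u y"
      "\<bar>wd v (h *v x)\<bar> < wd v x" "\<bar>wd v (h *v y)\<bar> < wd v y"
    using n[OF l] m(1-4) by (metis power2_abs power2_less_imp_less)+
  then obtain A B where AB: "A \<in> SQ L (away L L')" "B \<in> SQ L' (away L' L)" "h ** B = A"
    using stem_quadrant_factorisation[OF L(1) L'(1) l h] unfolding aL aL' unfolding L(2) L'(2) by blast
  have "B \<in> SL2" using AB(2) by (simp add: SQ_def)
  then have "h = A ** matrix_inv B"
    unfolding AB(3)[symmetric] by (simp add: matrix_mul_assoc[symmetric] matrix_inv_SL2(2))
  then show "matrix_inv g ** g' \<in> setmul (SQ L (away L L')) (setinv (SQ L' (away L' L)))"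
    using AB(1,2) unfolding h_def setmul_def setinv_def by blast
qed

theorem theoremB2:
  fixes L L' :: "complex set" and g g' :: "real^2^2"
  assumes "is_geod L" and "is_geod L'" and "g \<in> SL2" and "g' \<in> SL2"
  shows "(translate g (Cstar L) \<inter> translate g' (Cstar L') = {} \<longrightarrow>
            (L \<inter> L' = {} \<and>
             matrix_inv g ** g' \<in> setmul (SQ L (away L L')) (setinv (SQ L' (away L' L)))))
       \<and> ((mob g ` L \<inter> mob g' ` L' = {} \<and>
            mob g ` away L L' = away (mob g ` L) (mob g' ` L') \<and>
            mob g' ` away L' L = away (mob g' ` L') (mob g ` L) \<and>
            L \<inter> L' = {} \<and>
            matrix_inv g ** g' \<in> setmul (SQ L (away L L')) (setinv (SQ L' (away L' L))))
          \<longrightarrow> translate g (Cstar L) \<inter> translate g' (Cstar L') = {})"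
proof -
  obtain p q where L: "p \<noteq> q" "L = geod p q" using assms(1) unfolding is_geod_def by blast
  obtain p' q' where L': "p' \<noteq> q'" "L' = geod p' q'" using assms(2) unfolding is_geod_def by blast
  show ?thesis
    using translates_disjoint_imp_stem_quadrants[OF L L' assms(3,4)] stem_quadrants_imp_translates_disjoint[OF L L' assms(3,4)]
    by blast
qed

end
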